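(* For every integer $k\ge 1$ let $d_k(n)$ be defined by $\sum_{n=0}^\infty d_k(n)q^n=\dfrac{f_2^k}{f_1^{3k+1}}$, where $f_m:=\prod_{i=1}^\infty(1-q^{mi})$. Then for all integers $n\ge 0$ and $j\ge 0$: \begin{align*} d_{8j+7}(8n+6)&\equiv 0 \pmod{8}, & d_{8j+7}(8n+7)&\equiv 0 \pmod{16},\\ d_{16j+7}(8n+6)&\equiv 0 \pmod{16}, & d_{16j+7}(16n+11)&\equiv 0 \pmod{16},\\ d_{16j+15}(4n+3)&\equiv 0 \pmod{16}, & d_{16j+15}(8n+6)&\equiv 0 \pmod{16},\\ d_{16j+15}(16n+10)&\equiv 0 \pmod{16}, & d_{32j+31}(4n+3)&\equiv 0 \pmod{32},\\ d_{16j+15}(8n+7)&\equiv 0 \pmod{64}, & d_{32j+31}(8n+7)&\equiv 0 \pmod{128}. \end{align*}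
   Context: Here $|q|<1$ and $f_m:=(q^m;q^m)_\infty=\prod_{i=1}^\infty(1-q^{mi})$. The number $d_k(n)$ counts the partitions obtained by adding the links of the $k$-elongated plane partition diamonds of length $n$; all that is needed is its generating function $\sum_{n\ge0}d_k(n)q^n=f_2^k/f_1^{3k+1}$. *)

theory Defs
  imports "HOL-Analysis.Analysis" "HOL-Number_Theory.Cong"
begin

text \<open>
  The q-series are formal power series over the integers. Infinite products of formal power
  series are taken in the library's topology on \<^typ>\<open>int fps\<close>, in which a sequence converges iff
  each coefficient is eventually constant.
\<close>

definition euler_f :: "nat \<Rightarrow> int fps" where
  "euler_f m = (\<Prod>i. 1 - fps_X ^ (m * Suc i))"

text \<open>
  The library's division of power series needs an inverse operation on the coefficients, which
  \<^typ>\<open>int\<close> does not have. Here the denominator has constant coefficient 1, so its reciprocal is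
  the inverse series whose constant coefficient is 1; see \<open>diamond_gf_mult\<close>.
\<close>

definition diamond_gf :: "nat \<Rightarrow> int fps" where
  "diamond_gf k = euler_f 2 ^ k * fps_right_inverse (euler_f 1 ^ (3 * k + 1)) 1"

definition diamond_d :: "nat \<Rightarrow> nat \<Rightarrow> int" where
  "diamond_d k n = fps_nth (diamond_gf k) n"

lemma euler_f_has_prod:
  assumes "m > 0"
  shows "(\<lambda>i. 1 - fps_X ^ (m * Suc i) :: int fps) has_prod euler_f m"
    and "fps_nth (euler_f m) 0 = 1"
proof -
  define P where "P = (\<lambda>N. \<Prod>i\<le>N. (1 - fps_X ^ (m * Suc i) :: int fps))"
  define G where "G = Abs_fps (\<lambda>n. fps_nth (P n) n)"
  have step: "fps_nth (P (Suc N)) n = fps_nth (P N) n" if "n \<le> N" for N n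
  proof -
    have "1 * Suc (Suc N) \<le> m * Suc (Suc N)"
      using assms by (intro mult_le_mono1) simp
    moreover have "n < 1 * Suc (Suc N)"
      using that by simp
    ultimately have "n < m * Suc (Suc N)"
      by (rule less_le_trans [rotated])
    thus ?thesis
      by (simp add: P_def ring_distribs fps_X_power_mult_right_nth del: mult_Suc_right power_Suc)
  qed
  have stable: "fps_nth (P N) n = fps_nth G n" if "n \<le> N" for N n
    using that by (induction rule: dec_induct) (simp_all add: G_def step)
  have lim: "P \<longlonglongrightarrow> G"
    by (rule tendsto_fpsI) (use stable eventually_ge_at_top in \<open>blast intro: eventually_mono\<close>)
  have G0: "fps_nth G 0 = 1"
    using assms by (simp add: G_def P_def)
  hence "G \<noteq> 0"
    by auto
  with lim have "(\<lambda>i. 1 - fps_X ^ (m * Suc i) :: int fps) has_prod G"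
    by (simp add: has_prod_def raw_has_prod_def P_def)
  moreover from this have "euler_f m = G"
    unfolding euler_f_def by (rule has_prod_unique [symmetric])
  ultimately show "(\<lambda>i. 1 - fps_X ^ (m * Suc i) :: int fps) has_prod euler_f m"
    and "fps_nth (euler_f m) 0 = 1"
    using G0 by simp_all
qed

lemma diamond_gf_mult: "diamond_gf k * euler_f 1 ^ (3 * k + 1) = euler_f 2 ^ k"
proof -
  have "fps_nth (euler_f 1 ^ (3 * k + 1)) 0 = 1"
    by (simp add: fps_nth_power_0 euler_f_has_prod(2))
  hence "euler_f 1 ^ (3 * k + 1) * fps_right_inverse (euler_f 1 ^ (3 * k + 1)) 1 = 1"
    by (intro fps_right_inverse) simp
  thus ?thesis
    by (simp add: diamond_gf_def mult.assoc mult.commute del: power_Suc)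
qed

end

theory Submission
  imports Defs
begin

text \<open>
  Let \<open>\<phi>(q) = \<Sum> q\<^bsup>n\<^sup>2\<^esup>\<close>, summed over all integers, and \<open>\<psi>(q) = \<Sum> q\<^bsup>n(n+1)/2\<^esup>\<close>, summed over \<open>n \<ge> 0\<close>.
  Gauss' product \<open>f\<^sub>1\<^sup>2 = f\<^sub>2 \<phi>(-q)\<close>, iterated, and \<open>\<phi>(q) \<phi>(-q) = \<phi>(-q\<^sup>2)\<^sup>2\<close> turn the generating
  function for \<open>k = 8m - 1\<close> into the reciprocal of
  \<open>f\<^sub>8\<^bsup>m\<^esup> \<phi>(-q\<^sup>4)\<^bsup>m\<^esup> \<phi>(q)\<^bsup>m\<^esup> \<phi>(-q)\<^bsup>13m-1\<^esup>\<close>. Modulo 128 the 64-th power of each theta function is 1, so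
  the generating function times a series in \<open>q\<^sup>8\<close> becomes a polynomial in \<open>W = \<phi>(q\<^sup>4)\<close> and
  \<open>x = 2q\<psi>(q\<^sup>8)\<close>, because \<open>\<phi>(q) = W + x\<close> and \<open>\<phi>(-q) = W - x\<close>. Only the terms in \<open>x\<^bsup>i\<^esup>\<close> with
  \<open>i \<equiv> r\<close> modulo 4 contribute to exponents congruent to \<open>r\<close> modulo 4, each is divisible by \<open>2\<^bsup>i\<^esup>\<close>, and
  \<open>W\<close> modulo 2 and \<open>W\<^sup>2\<close> modulo 4 are again series in \<open>q\<^sup>8\<close>. This leaves the coefficients of \<open>x\<^sup>2\<close> and
  \<open>x\<^sup>3\<close>, which are explicit. For the exponents \<open>16n + 10\<close> and \<open>16n + 11\<close> one also uses
  \<open>\<psi>(q) f\<^sub>1 = f\<^sub>2\<^sup>2\<close>.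
\<close>

subsection \<open>Shanks' finite forms of Gauss' theta identities\<close>

text \<open>The differences \<open>A (Suc n) s - (1 + q ^ Suc n) * A n s\<close> of the right-hand
  summands telescope in \<open>s\<close>, which drives the induction on \<open>n\<close>. With
  denominators cleared, this works in any commutative ring.\<close>

lemma gauss_theta_finite:
  fixes q :: "'a :: comm_ring_1"
  shows "(1 + 2 * (\<Sum>s<n. (-1) ^ Suc s * q ^ (Suc s)\<^sup>2)) * (\<Prod>i<n. 1 + q ^ Suc i) =
    (\<Sum>s\<le>n. (-1) ^ s * q ^ (s * Suc n) * (\<Prod>i=s..<n. 1 - q ^ Suc i) * (\<Prod>i<s. 1 + q ^ i))"
proof (induction n)
  case 0
  show ?case by simp
next
  case (Suc n)
  define B where "B = (\<lambda>s. \<Prod>i=s..<n. 1 - q ^ Suc i)"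
  define C where "C = (\<lambda>s. \<Prod>i<s. 1 + q ^ i)"
  define A where "A = (\<lambda>N s. (-1) ^ s * q ^ (s * Suc N) * (\<Prod>i=s..<N. 1 - q ^ Suc i) * C s)"
  have B_step: "B s = (1 - q ^ Suc s) * B (Suc s)" if "s < n" for s
    using that by (simp add: B_def prod.atLeast_Suc_lessThan)
  have A_n: "A n s = (-1) ^ s * q ^ (s * Suc n) * B s * C s" for s
    by (simp add: A_def B_def)
  have A_Suc: "A (Suc n) s = (-1) ^ s * q ^ (s * Suc n) * q ^ s * B s * (1 - q ^ Suc n) * C s"
    if "s \<le> n" for s
    using that by (simp add: A_def B_def power_add algebra_simps)
  have C_Suc: "C (Suc s) = C s * (1 + q ^ s)" for s
    by (simp add: C_def)
  have tele: "(\<Sum>s\<le>k. A (Suc n) s - (1 + q ^ Suc n) * A n s) =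
      - ((-1) ^ k * q ^ (Suc k * Suc n) * B k * C (Suc k))" if "k \<le> n" for k
    using that
  proof (induction k)
    case 0
    have "B 0 * (1 - q ^ Suc n) - (1 + q ^ Suc n) * B 0 = - 2 * q ^ Suc n * B 0"
      by (simp add: algebra_simps)
    thus ?case
      by (simp add: A_n A_Suc C_def del: power_Suc)
  next
    case (Suc k)
    define u where "u = q ^ Suc n"
    define v where "v = q ^ Suc k"
    define y where "y = (-1) ^ k * q ^ (Suc k * Suc n) * B (Suc k) * C (Suc k)"
    have 1: "A (Suc n) (Suc k) = - y * v * (1 - u)"
      using Suc.prems by (simp add: A_Suc y_def u_def v_def del: mult_Suc mult_Suc_right power_Suc) simp
    have 2: "A n (Suc k) = - y"
      by (simp add: A_n y_def del: mult_Suc mult_Suc_right power_Suc) simp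
    have 3: "(-1) ^ k * q ^ (Suc k * Suc n) * B k * C (Suc k) = y * (1 - v)"
      using Suc.prems by (simp add: B_step y_def v_def del: mult_Suc mult_Suc_right power_Suc)
    have 4: "(-1) ^ Suc k * q ^ (Suc (Suc k) * Suc n) * B (Suc k) * C (Suc (Suc k)) = - y * u * (1 + v)"
      unfolding C_Suc[of "Suc k"] y_def u_def v_def mult_Suc[of "Suc k"] power_add by simp
    have "(\<Sum>s\<le>Suc k. A (Suc n) s - (1 + q ^ Suc n) * A n s) =
        - (y * (1 - v)) + (- y * v * (1 - u) - (1 + u) * (- y))"
      using Suc by (simp only: sum.atMost_Suc 1 2 3 u_def[symmetric])
    also have "\<dots> = - (- y * u * (1 + v))"
      by (simp add: algebra_simps)
    finally show ?case by (simp only: 4)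
  qed
  \<comment> \<open>\<open>C\<close> starts with the factor \<open>1 + q ^ 0 = 2\<close>; this is
    the 2 in front of the sum over squares.\<close>
  have C_eq: "C (Suc N) = 2 * (\<Prod>i<N. 1 + q ^ Suc i)" for N
    by (induction N) (simp_all add: C_def)
  define T where "T = 1 + 2 * (\<Sum>s<n. (-1) ^ Suc s * q ^ (Suc s)\<^sup>2)"
  define P where "P = (\<Prod>i<n. 1 + q ^ Suc i)"
  define t where "t = (-1) ^ Suc n * q ^ (Suc n)\<^sup>2"
  have IH: "T * P = (\<Sum>s\<le>n. A n s)"
    unfolding T_def P_def A_def C_def by (rule Suc.IH)
  have "(\<Sum>s\<le>n. A (Suc n) s) =
      (\<Sum>s\<le>n. A (Suc n) s - (1 + q ^ Suc n) * A n s) + (1 + q ^ Suc n) * (\<Sum>s\<le>n. A n s)"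
    by (simp add: sum_subtractf sum_distrib_left)
  moreover have "(\<Sum>s\<le>n. A (Suc n) s - (1 + q ^ Suc n) * A n s) = t * (2 * P)"
    unfolding P_def C_eq[symmetric] t_def
    by (subst tele) (simp_all add: B_def power2_eq_square)
  moreover have "A (Suc n) (Suc n) = t * q ^ Suc n * (2 * P)"
    unfolding P_def C_eq[symmetric] t_def
  proof -
    have "Suc n * Suc (Suc n) = (Suc n)\<^sup>2 + Suc n"
      by (simp add: power2_eq_square)
    thus "A (Suc n) (Suc n) = (-1) ^ Suc n * q ^ (Suc n)\<^sup>2 * q ^ Suc n * C (Suc n)"
      unfolding A_def by (simp only: power_add) simp
  qed
  ultimately have "(\<Sum>s\<le>Suc n. A (Suc n) s) = (T + 2 * t) * (P * (1 + q ^ Suc n))"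
    unfolding IH[symmetric] by (simp add: algebra_simps)
  thus ?case
    unfolding A_def C_def T_def P_def t_def
    by (simp only: sum.lessThan_Suc prod.lessThan_Suc distrib_left add.assoc)
qed

text \<open>The same telescoping, now with the factor \<open>1 - q ^ (2 * n + 1)\<close>. Raising
  \<open>n\<close> by one adds two triangular exponents, hence the range
  \<open>s < 2 * n\<close>.\<close>

lemma gauss_triangular_finite:
  fixes q :: "'a :: comm_ring_1"
  shows "(\<Sum>s<2 * n. q ^ (s * Suc s div 2)) * (\<Prod>i<n. 1 - q ^ (2 * i + 1)) =
    (\<Sum>s<n. q ^ (s * (2 * n + 1)) * (\<Prod>i=s..<n. 1 - q ^ (2 * Suc i)) * (\<Prod>i<s. 1 - q ^ (2 * i + 1)))"
proof (induction n)
  case 0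
  show ?case by simp
next
  case (Suc n)
  define B where "B = (\<lambda>s. \<Prod>i=s..<n. 1 - q ^ (2 * Suc i))"
  define C where "C = (\<lambda>s. \<Prod>i<s. 1 - q ^ (2 * i + 1))"
  define A where "A = (\<lambda>N s. q ^ (s * (2 * N + 1)) * (\<Prod>i=s..<N. 1 - q ^ (2 * Suc i)) * C s)"
  define u where "u = q ^ (2 * n + 1)"
  define t where "t = q ^ (n * (2 * n + 1))"
  have B_step: "B s = (1 - q ^ (2 * Suc s)) * B (Suc s)" if "s < n" for s
    using that by (simp add: B_def prod.atLeast_Suc_lessThan)
  have C_Suc: "C (Suc s) = C s * (1 - q ^ (2 * s + 1))" for s
    by (simp add: C_def)
  have A_n: "A n s = q ^ (s * (2 * n + 1)) * B s * C s" for s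
    by (simp add: A_def B_def)
  have A_Suc: "A (Suc n) s = q ^ (s * (2 * n + 1)) * q ^ (2 * s) * B s * (1 - u * q) * C s"
    if "s \<le> n" for s
    using that by (simp add: A_def B_def u_def power_add algebra_simps)
  have tele: "(\<Sum>s\<le>k. A (Suc n) s - (1 - u) * A n s) = q ^ (k * (2 * n + 1)) * u * B k * C (Suc k)"
    if "k < n" for k
    using that
  proof (induction k)
    case 0
    thus ?case
      by (simp add: A_n A_Suc C_def) (simp add: algebra_simps)
  next
    case (Suc k)
    define v where "v = q ^ (2 * Suc k)"
    define y where "y = q ^ (Suc k * (2 * n + 1)) * B (Suc k) * C (Suc k)"
    have 1: "A (Suc n) (Suc k) = y * v * (1 - u * q)"
      using Suc.prems by (simp add: A_Suc y_def v_def mult_ac del: mult_Suc mult_Suc_right power_Suc)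
    have 2: "A n (Suc k) = y"
      by (simp add: A_n y_def)
    have 3: "q ^ (k * (2 * n + 1)) * u * B k * C (Suc k) = y * (1 - v)"
      using Suc.prems by (simp add: B_step y_def v_def u_def power_add mult_ac)
    have 4: "q ^ (Suc k * (2 * n + 1)) * u * B (Suc k) * C (Suc (Suc k)) = y * u * (1 - v * q)"
      unfolding C_Suc[of "Suc k"] y_def v_def by (simp add: mult_ac)
    have "(\<Sum>s\<le>Suc k. A (Suc n) s - (1 - u) * A n s) =
        y * (1 - v) + (y * v * (1 - u * q) - (1 - u) * y)"
      using Suc by (simp only: sum.atMost_Suc 1 2 3)
    also have "\<dots> = y * u * (1 - v * q)"
      by (simp add: algebra_simps)
    finally show ?case by (simp only: 4)
  qed
  define T where "T = (\<Sum>s<2 * n. q ^ (s * Suc s div 2))"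
  have IH: "T * C n = (\<Sum>s<n. A n s)"
    unfolding T_def A_def C_def by (rule Suc.IH)
  have "(\<Sum>s<n. A (Suc n) s - (1 - u) * A n s) = t * (1 - q ^ (2 * n)) * C n"
  proof (cases n)
    case (Suc m)
    have "t = q ^ (m * (2 * n + 1)) * u"
      unfolding t_def u_def power_add[symmetric] by (simp add: Suc)
    moreover have "B m = 1 - q ^ (2 * n)"
      by (simp add: B_def Suc)
    ultimately show ?thesis
      using tele[of m] by (simp add: Suc lessThan_Suc_atMost)
  qed simp
  moreover have "(\<Sum>s<n. A (Suc n) s) =
      (\<Sum>s<n. A (Suc n) s - (1 - u) * A n s) + (1 - u) * (\<Sum>s<n. A n s)"
    by (simp add: sum_subtractf sum_distrib_left)
  moreover have "A (Suc n) n = t * q ^ (2 * n) * (1 - u * q) * C n"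
    by (simp add: A_Suc B_def t_def)
  ultimately have "(\<Sum>s<Suc n. A (Suc n) s) =
      t * (1 - q ^ (2 * n)) * C n + (1 - u) * (T * C n) + t * q ^ (2 * n) * (1 - u * q) * C n"
    unfolding IH by simp
  \<comment> \<open>\<open>t\<close> and \<open>t * u\<close> are the two new triangular powers; the
    last term is zero since \<open>u = q ^ (2 * n) * q\<close>.\<close>
  also have "\<dots> = (T + t * (1 + u)) * (C n * (1 - u)) + t * C n * (u * u - q ^ (2 * n) * u * q)"
    by (simp add: algebra_simps)
  also have "u * u - q ^ (2 * n) * u * q = 0"
    by (simp add: u_def mult_ac)
  also have "T + t * (1 + u) = (\<Sum>s<2 * Suc n. q ^ (s * Suc s div 2))"
  proof -
    have 0: "2 * Suc n = Suc (Suc (2 * n))"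
      by simp
    have 1: "2 * n * Suc (2 * n) div 2 = n * (2 * n + 1)"
      by (metis Suc_eq_plus1 mult.assoc nonzero_mult_div_cancel_left zero_neq_numeral)
    have 2: "Suc (2 * n) * Suc (Suc (2 * n)) = 2 * (n * (2 * n + 1) + (2 * n + 1))"
      by (simp add: algebra_simps)
    have 2: "Suc (2 * n) * Suc (Suc (2 * n)) div 2 = n * (2 * n + 1) + (2 * n + 1)"
      unfolding 2 by simp
    show ?thesis
      unfolding T_def t_def u_def by (simp only: 0 sum.lessThan_Suc 1 2 distrib_left power_add) simp
  qed
  finally show ?case
    by (simp add: A_def C_def u_def)
qed

subsection \<open>Theta functions and Euler products\<close>

text \<open>Congruence modulo \<open>X^(n+1)\<close>: infinite sums and products are compared
  through finite truncations for every \<open>n\<close>.\<close>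

definition agree :: "nat \<Rightarrow> 'a :: comm_ring_1 fps \<Rightarrow> 'a fps \<Rightarrow> bool" where
  "agree n F G \<longleftrightarrow> (\<forall>i\<le>n. fps_nth F i = fps_nth G i)"

lemma agree_refl [simp]: "agree n F F"
  by (simp add: agree_def)

lemma agree_sym: "agree n F G \<Longrightarrow> agree n G F"
  by (simp add: agree_def)

lemma agree_trans [trans]: "agree n F G \<Longrightarrow> agree n G H \<Longrightarrow> agree n F H"
  by (simp add: agree_def)

lemma agree_mono: "agree n F G \<Longrightarrow> m \<le> n \<Longrightarrow> agree m F G"
  by (simp add: agree_def)

lemma agree_add: "agree n F G \<Longrightarrow> agree n F' G' \<Longrightarrow> agree n (F + F') (G + G')"
  by (simp add: agree_def)

lemma agree_diff: "agree n F G \<Longrightarrow> agree n F' G' \<Longrightarrow> agree n (F - F') (G - G')"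
  by (simp add: agree_def)

lemma agree_mult: "agree n F G \<Longrightarrow> agree n F' G' \<Longrightarrow> agree n (F * F') (G * G')"
  unfolding agree_def fps_mult_nth by (auto intro!: sum.cong)

lemma agree_power: "agree n F G \<Longrightarrow> agree n (F ^ k) (G ^ k)"
  by (induction k) (auto intro: agree_mult)

lemma agree_eqI: "(\<And>n. agree n F G) \<Longrightarrow> F = G"
  by (auto simp: agree_def fps_eq_iff)

lemma agree_high_power:
  assumes "fps_nth q 0 = 0" "n < k"
  shows "agree n (F * q ^ k * G) 0"
proof -
  have "agree n (q ^ k) 0"
    using assms startsby_zero_power_prefix[of q k] by (simp add: agree_def)
  hence "agree n (F * q ^ k * G) (F * 0 * G)"
    by (intro agree_mult agree_refl)
  thus ?thesis by simp
qed

lemma agree_sum_zero: "(\<And>s. s \<in> A \<Longrightarrow> agree n (F s) 0) \<Longrightarrow> agree n (\<Sum>s\<in>A. F s) 0"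
  by (simp add: agree_def fps_sum_nth)

text \<open>In Shanks' sum every term with \<open>s >= 1\<close> has order above \<open>n\<close>,
  so only \<open>s = 0\<close> survives. \<open>q\<close> stays general because both
  \<open>X^m\<close> and \<open>-X\<close> are substituted.\<close>

lemma agree_theta:
  fixes q :: "'a :: comm_ring_1 fps"
  assumes "fps_nth q 0 = 0"
  shows "agree n ((1 + 2 * (\<Sum>s<n. (-1) ^ Suc s * q ^ (Suc s)\<^sup>2)) * (\<Prod>i<n. 1 - (q ^ 2) ^ Suc i))
    ((\<Prod>i<n. 1 - q ^ Suc i) ^ 2)"
proof -
  define T where "T = (1 + 2 * (\<Sum>s<n. (-1) ^ Suc s * q ^ (Suc s)\<^sup>2))"
  define P where "P = (\<Prod>i<n. 1 - q ^ Suc i)"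
  define A where "A = (\<lambda>s. (-1) ^ s * q ^ (s * Suc n) *
    ((\<Prod>i=s..<n. 1 - q ^ Suc i) * (\<Prod>i<s. 1 + q ^ i)))"
  have prod: "(\<Prod>i<n. 1 - (q ^ 2) ^ Suc i) = (\<Prod>i<n. 1 + q ^ Suc i) * P"
    unfolding P_def prod.distrib [symmetric]
    by (intro prod.cong) (simp_all add: power2_eq_square power_mult_distrib algebra_simps)
  have less: "n < s * Suc n" if "s \<in> {1..n}" for s
    using that mult_le_mono1[of 1 s "Suc n"] by simp
  have "T * (\<Prod>i<n. 1 + q ^ Suc i) = (\<Sum>s\<le>n. A s)"
    unfolding T_def A_def gauss_theta_finite by (simp add: mult.assoc)
  also have "\<dots> = P + (\<Sum>s=1..n. A s)"
    by (subst sum.atMost_shift) (simp add: A_def P_def lessThan_atLeast0 sum.atLeast1_atMost_eq)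
  also have "agree n \<dots> (P + 0)"
    unfolding A_def
    by (intro agree_add agree_sum_zero agree_refl agree_high_power less assms)
  finally have "agree n (T * (\<Prod>i<n. 1 + q ^ Suc i) * P) (P * P)"
    by (intro agree_mult) simp_all
  thus ?thesis
    unfolding prod T_def [symmetric] P_def [symmetric] by (simp add: power2_eq_square mult.assoc)
qed

text \<open>Again only \<open>s = 0\<close> survives. For \<open>n = 0\<close> the sum would be
  empty and the right side 1, hence \<open>n > 0\<close>.\<close>

lemma agree_triangular:
  fixes q :: "'a :: comm_ring_1 fps"
  assumes "fps_nth q 0 = 0" "n > 0"
  shows "agree n ((\<Sum>s<2 * n. q ^ (s * Suc s div 2)) * (\<Prod>i<2 * n. 1 - q ^ Suc i))
    ((\<Prod>i<n. 1 - (q ^ 2) ^ Suc i) ^ 2)"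
proof -
  define T where "T = (\<Sum>s<2 * n. q ^ (s * Suc s div 2))"
  define P where "P = (\<Prod>i<n. 1 - (q ^ 2) ^ Suc i)"
  define A where "A = (\<lambda>s. 1 * q ^ (s * (2 * n + 1)) *
    ((\<Prod>i=s..<n. 1 - (q ^ 2) ^ Suc i) * (\<Prod>i<s. 1 - q ^ (2 * i + 1))))"
  have prod: "(\<Prod>i<2 * n. 1 - q ^ Suc i) = (\<Prod>i<n. 1 - q ^ (2 * i + 1)) * P"
  proof -
    have "P = (\<Prod>i<n. 1 - q ^ (2 * i + 2))"
      unfolding P_def by (simp add: power_mult [symmetric]) (simp add: power2_eq_square mult.assoc)
    thus ?thesis by (induction n arbitrary: P) (simp_all add: mult_ac)
  qed
  have "agree n (T * (\<Prod>i<n. 1 - q ^ (2 * i + 1))) P"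
  proof -
    obtain m where Suc: "n = Suc m"
      using assms(2) by (cases n) auto
    have less: "n < s * (2 * n + 1)" if "s \<in> {1..m}" for s
      using that mult_le_mono1[of 1 s "2 * n + 1"] by simp
    have "T * (\<Prod>i<n. 1 - q ^ (2 * i + 1)) = (\<Sum>s<n. A s)"
      unfolding T_def A_def gauss_triangular_finite
      by (simp add: mult.assoc power_mult) (simp add: power2_eq_square mult.assoc)
    also have "\<dots> = P + (\<Sum>s=1..m. A s)"
      unfolding Suc lessThan_Suc_atMost
      by (subst sum.atMost_shift) (simp add: A_def P_def Suc lessThan_atLeast0 sum.atLeast1_atMost_eq)
    also have "agree n \<dots> (P + 0)"
      unfolding A_def by (intro agree_add agree_sum_zero agree_refl agree_high_power less assms(1))
    finally show ?thesis by simp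
  qed
  hence "agree n (T * (\<Prod>i<n. 1 - q ^ (2 * i + 1)) * P) (P * P)"
    by (intro agree_mult) simp_all
  thus ?thesis
    unfolding prod T_def [symmetric] P_def [symmetric] by (simp add: power2_eq_square mult.assoc)
qed

text \<open>This is the sum of the monomials \<open>q\<^bsup>e s\<^esup>\<close> only if \<^term>\<open>s \<le> e s\<close>, since the coefficient of
  \<open>q\<^bsup>n\<^esup>\<close> is read off the terms with \<^term>\<open>s \<le> n\<close>.\<close>

definition lacunary :: "(nat \<Rightarrow> nat) \<Rightarrow> int fps" where
  "lacunary e = Abs_fps (\<lambda>n. fps_nth (\<Sum>s\<le>n. fps_X ^ e s) n)"

lemma agree_lacunary:
  assumes "\<And>s. s \<le> e s" "n < N"
  shows "agree n (lacunary e) (\<Sum>s<N. fps_X ^ e s)"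
  unfolding agree_def
proof safe
  fix i assume "i \<le> n"
  have "(\<Sum>s<N. fps_nth (fps_X ^ e s) i :: int) = (\<Sum>s\<le>i. fps_nth (fps_X ^ e s) i)"
    using assms \<open>i \<le> n\<close>
    by (intro sum.mono_neutral_right) (auto simp: fps_X_power_iff dest: order.trans[OF assms(1)])
  thus "fps_nth (lacunary e) i = fps_nth (\<Sum>s<N. fps_X ^ e s) i"
    by (simp add: lacunary_def fps_sum_nth)
qed

text \<open>Passes from the limit to finite products: factors past the first \<open>n\<close> differ
  from 1 only at exponents above \<open>n\<close>.\<close>

lemma agree_euler_f:
  assumes "m > 0" "n \<le> N"
  shows "agree n (euler_f m) (\<Prod>i<N. 1 - (fps_X ^ m) ^ Suc i)"
proof -
  define P where "P = (\<lambda>N. \<Prod>i<N. (1 - (fps_X ^ m) ^ Suc i :: int fps))"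
  have step: "agree n (P N) (P n)" if "n \<le> N" for n N
    using that
  proof (induction rule: dec_induct)
    case (step k)
    have "agree n (P (Suc k)) (P k - 0)"
      unfolding P_def prod.lessThan_Suc right_diff_distrib mult_1_right
      using agree_high_power[of "fps_X ^ m" n "Suc k" "P k" 1] step assms(1)
      by (intro agree_diff agree_refl) (simp_all add: P_def)
    thus ?case using step.IH by (auto intro: agree_trans)
  qed simp
  have "P \<longlonglongrightarrow> euler_f m"
    using has_prod_imp_tendsto'[OF euler_f_has_prod(1)[OF assms(1)]]
    by (simp add: P_def[abs_def] power_mult [symmetric] del: mult_Suc_right power_Suc)
  hence lim: "\<forall>\<^sub>F N in sequentially. fps_nth (P N) i = fps_nth (euler_f m) i" for i
    by (simp add: tendsto_fps_iff)
  have "fps_nth (euler_f m) i = fps_nth (P N) i" if "i \<le> N" for i N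
  proof -
    from lim [of i] obtain K
      where K: "N \<ge> K \<Longrightarrow> fps_nth (P N) i = fps_nth (euler_f m) i" for N
      by (auto simp: eventually_sequentially)
    have "agree N (P (max N K)) (P N)"
      by (intro step) simp
    thus ?thesis using K[of "max N K"] that by (simp add: agree_def)
  qed
  hence "agree n (euler_f m) (P N)"
    using assms(2) unfolding agree_def by (meson order.trans)
  thus ?thesis by (simp add: P_def)
qed

section \<open>Theta series and Gauss' product identities\<close>

definition phi :: "nat \<Rightarrow> int fps" where
  "phi m = 1 + 2 * lacunary (\<lambda>s. m * (Suc s)\<^sup>2)"

definition psi :: "nat \<Rightarrow> int fps" where
  "psi m = lacunary (\<lambda>s. m * (s * Suc s div 2))"

text \<open>Ramanujan's \<open>\<phi>(-q\<^sup>m)\<close>, already separated into its terms with even and with odd index; in this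
  notation \<open>phi m\<close> and \<open>psi m\<close> are \<open>\<phi>(q\<^sup>m)\<close> and \<open>\<psi>(q\<^sup>m)\<close>.\<close>

definition phi_minus :: "nat \<Rightarrow> int fps" where
  "phi_minus m = phi (4 * m) - 2 * fps_X ^ m * psi (8 * m)"

lemma agree_phi:
  assumes "m > 0" "n < N"
  shows "agree n (phi m) (1 + 2 * (\<Sum>s<N. fps_X ^ (m * (Suc s)\<^sup>2)))"
proof -
  have "s \<le> m * (Suc s)\<^sup>2" for s
  proof -
    have "1 * s \<le> m * (Suc s)\<^sup>2"
      using assms(1) by (intro mult_mono) (auto simp: power2_eq_square)
    thus ?thesis by simp
  qed
  thus ?thesis
    unfolding phi_def using assms(2) by (intro agree_add agree_mult agree_lacunary agree_refl)
qed

lemma agree_psi: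
  assumes "m > 0" "n < N"
  shows "agree n (psi m) (\<Sum>s<N. fps_X ^ (m * (s * Suc s div 2)))"
proof -
  have "s \<le> m * (s * Suc s div 2)" for s
  proof -
    have "1 * s \<le> m * (s * Suc s div 2)"
      using assms(1) by (intro mult_mono) (cases s; auto)+
    thus ?thesis by simp
  qed
  thus ?thesis
    unfolding psi_def using assms(2) by (intro agree_lacunary)
qed

text \<open>Even \<open>s\<close> gives the odd squares, and
  \<open>(2N+1)^2 = 1 + 8 N(N+1)/2\<close>. Their weight \<open>c\<close> is 1 for
  \<open>phi\<close> and -1 for \<open>phi_minus\<close>.\<close>

lemma square_sum_split:
  fixes c :: "int fps"
  shows "(\<Sum>s<2 * N. (if even s then c else 1) * fps_X ^ (m * (Suc s)\<^sup>2)) =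
    (\<Sum>s<N. fps_X ^ (4 * m * (Suc s)\<^sup>2)) + c * fps_X ^ m * (\<Sum>s<N. fps_X ^ (8 * m * (s * Suc s div 2)))"
proof (induction N)
  case (Suc N)
  define w where "w = N * Suc N div 2"
  have w: "N * Suc N = 2 * w"
    by (simp add: w_def)
  have "m * (Suc (2 * N))\<^sup>2 = m + 4 * m * (N * Suc N)"
    by (simp add: power2_eq_square algebra_simps)
  hence odd: "m * (Suc (2 * N))\<^sup>2 = m + 8 * m * (N * Suc N div 2)"
    unfolding w_def [symmetric] w by simp
  have even: "m * (Suc (Suc (2 * N)))\<^sup>2 = 4 * m * (Suc N)\<^sup>2"
    by (simp add: power2_eq_square algebra_simps)
  have two: "2 * Suc N = Suc (Suc (2 * N))"
    by simp
  have parity: "even (2 * N)" "\<not> even (Suc (2 * N))"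
    by simp_all
  have "(\<Sum>s<2 * Suc N. (if even s then c else 1) * fps_X ^ (m * (Suc s)\<^sup>2)) =
      (\<Sum>s<2 * N. (if even s then c else 1) * fps_X ^ (m * (Suc s)\<^sup>2)) +
      c * (fps_X ^ m * fps_X ^ (8 * m * (N * Suc N div 2))) + fps_X ^ (4 * m * (Suc N)\<^sup>2)"
    unfolding two sum.lessThan_Suc odd even power_add by (simp only: parity if_True if_False mult_1)
  thus ?case
    unfolding Suc.IH sum.lessThan_Suc by (simp only: distrib_left mult.assoc ac_simps)
qed simp

lemma agree_phi_dissection:
  fixes c :: "int fps"
  assumes "m > 0"
  shows "agree n (phi (4 * m) + 2 * c * fps_X ^ m * psi (8 * m))
    (1 + 2 * (\<Sum>s<2 * Suc n. (if even s then c else 1) * fps_X ^ (m * (Suc s)\<^sup>2)))"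
proof -
  have "agree n (phi (4 * m) + 2 * c * fps_X ^ m * psi (8 * m))
    ((1 + 2 * (\<Sum>s<Suc n. fps_X ^ (4 * m * (Suc s)\<^sup>2))) +
      2 * c * fps_X ^ m * (\<Sum>s<Suc n. fps_X ^ (8 * m * (s * Suc s div 2))))"
    using assms by (intro agree_add agree_mult agree_refl agree_phi agree_psi) simp_all
  thus ?thesis
    unfolding square_sum_split by (simp only: distrib_left mult.assoc add.assoc)
qed

lemma phi_dissection:
  assumes "m > 0"
  shows "phi m = phi (4 * m) + 2 * fps_X ^ m * psi (8 * m)"
proof (rule agree_eqI)
  fix n
  have "agree n (phi m) (1 + 2 * (\<Sum>s<2 * Suc n. (if even s then 1 else 1) * fps_X ^ (m * (Suc s)\<^sup>2)))"
    using agree_phi[OF assms, of n "2 * Suc n"] by simp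
  also have "agree n \<dots> (phi (4 * m) + 2 * 1 * fps_X ^ m * psi (8 * m))"
    by (rule agree_sym [OF agree_phi_dissection [OF assms]])
  finally show "agree n (phi m) (phi (4 * m) + 2 * fps_X ^ m * psi (8 * m))"
    by simp
qed

lemma euler_f_square:
  assumes "m > 0"
  shows "euler_f m ^ 2 = euler_f (2 * m) * phi_minus m"
proof (rule agree_eqI)
  fix n
  define N where "N = 2 * Suc n"
  define q :: "int fps" where "q = fps_X ^ m"
  \<comment> \<open>The sign depends only on the parity of \<open>s\<close>, so the alternating
    series is the dissected one with \<open>c = -1\<close>.\<close>
  have "(-1) ^ Suc s * q ^ (Suc s)\<^sup>2 = (if even s then - 1 else 1) * fps_X ^ (m * (Suc s)\<^sup>2)" for s
    by (simp add: q_def power_mult)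
  hence "agree n (phi_minus m) (1 + 2 * (\<Sum>s<N. (-1) ^ Suc s * q ^ (Suc s)\<^sup>2))"
    using agree_phi_dissection[OF assms, of n "-1"] by (simp add: phi_minus_def N_def)
  moreover have "agree n (euler_f (2 * m)) (\<Prod>i<N. 1 - (q ^ 2) ^ Suc i)"
    using agree_euler_f[of "2 * m" n N] assms
    by (simp add: q_def N_def power_mult [symmetric] mult.commute)
  ultimately have "agree n (phi_minus m * euler_f (2 * m))
     ((1 + 2 * (\<Sum>s<N. (-1) ^ Suc s * q ^ (Suc s)\<^sup>2)) * (\<Prod>i<N. 1 - (q ^ 2) ^ Suc i))"
    by (rule agree_mult)
  also have "agree n \<dots> ((\<Prod>i<N. 1 - q ^ Suc i) ^ 2)"
    using assms by (intro agree_mono [OF agree_theta]) (simp_all add: q_def N_def)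
  also have "agree n \<dots> (euler_f m ^ 2)"
    unfolding q_def using assms by (intro agree_power agree_sym [OF agree_euler_f]) (simp_all add: N_def)
  finally show "agree n (euler_f m ^ 2) (euler_f (2 * m) * phi_minus m)"
    by (metis agree_sym mult.commute)
qed

lemma psi_euler_f:
  assumes "m > 0"
  shows "psi m * euler_f m = euler_f (2 * m) ^ 2"
proof (rule agree_eqI)
  fix n
  define N where "N = Suc n"
  define q :: "int fps" where "q = fps_X ^ m"
  have "agree n (psi m) (\<Sum>s<2 * N. q ^ (s * Suc s div 2))"
    using agree_psi[OF assms, of n "2 * N"] by (simp add: q_def N_def power_mult)
  moreover have "agree n (euler_f m) (\<Prod>i<2 * N. 1 - q ^ Suc i)"
    unfolding q_def using assms by (intro agree_euler_f) (simp_all add: N_def)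
  ultimately have "agree n (psi m * euler_f m)
     ((\<Sum>s<2 * N. q ^ (s * Suc s div 2)) * (\<Prod>i<2 * N. 1 - q ^ Suc i))"
    by (rule agree_mult)
  also have "agree n \<dots> ((\<Prod>i<N. 1 - (q ^ 2) ^ Suc i) ^ 2)"
    using assms by (intro agree_mono [OF agree_triangular]) (simp_all add: q_def N_def)
  also have "agree n \<dots> (euler_f (2 * m) ^ 2)"
    using agree_euler_f[of "2 * m" n N] assms
    by (intro agree_power agree_sym [of n "euler_f _"])
       (simp add: q_def N_def power_mult [symmetric] mult.commute)
  finally show "agree n (psi m * euler_f m) (euler_f (2 * m) ^ 2)" .
qed

text \<open>Finite, division-free form of \<open>f_1(-q) f_1(q) f_4 = f_2^3\<close>; each induction
  step adds the factors of index \<open>2n+1\<close> and \<open>2n+2\<close>.\<close>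

lemma prod_odd_even_factors:
  fixes q :: "'a :: comm_ring_1"
  shows "(\<Prod>i<2 * n. 1 - (- q) ^ Suc i) * (\<Prod>i<2 * n. 1 - q ^ Suc i) * (\<Prod>i<n. 1 - (q ^ 4) ^ Suc i) =
    (\<Prod>i<n. 1 - (q ^ 2) ^ Suc i) ^ 2 * (\<Prod>i<2 * n. 1 - (q ^ 2) ^ Suc i)"
proof (induction n)
  case (Suc n)
  define u where "u = q ^ Suc (2 * n)"
  define v where "v = q ^ (2 * Suc n)"
  have sgn: "(- q) ^ Suc (2 * n) = - u" "(- q) ^ Suc (Suc (2 * n)) = v"
    by (simp_all add: u_def v_def)
  have pow: "q ^ Suc (2 * n) = u" "q ^ Suc (Suc (2 * n)) = v" "(q ^ 2) ^ Suc n = v"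
    "(q ^ 4) ^ Suc n = v ^ 2" "(q ^ 2) ^ Suc (2 * n) = u ^ 2" "(q ^ 2) ^ Suc (Suc (2 * n)) = v ^ 2"
  proof -
    have "2 * Suc n = Suc (Suc (2 * n))" "4 * Suc n = Suc (Suc (2 * n)) * 2"
      "2 * Suc (2 * n) = Suc (2 * n) * 2" "2 * Suc (Suc (2 * n)) = Suc (Suc (2 * n)) * 2"
      by simp_all
    thus "q ^ Suc (2 * n) = u" "q ^ Suc (Suc (2 * n)) = v" "(q ^ 2) ^ Suc n = v"
      "(q ^ 4) ^ Suc n = v ^ 2" "(q ^ 2) ^ Suc (2 * n) = u ^ 2" "(q ^ 2) ^ Suc (Suc (2 * n)) = v ^ 2"
      unfolding u_def v_def power_mult [symmetric] by metis+
  qed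
  define A where "A = (\<Prod>i<2 * n. 1 - (- q) ^ Suc i) * (\<Prod>i<2 * n. 1 - q ^ Suc i) * (\<Prod>i<n. 1 - (q ^ 4) ^ Suc i)"
  have two: "2 * Suc n = Suc (Suc (2 * n))"
    by simp
  have "(\<Prod>i<2 * Suc n. 1 - (- q) ^ Suc i) * (\<Prod>i<2 * Suc n. 1 - q ^ Suc i) * (\<Prod>i<Suc n. 1 - (q ^ 4) ^ Suc i) =
      A * ((1 + u) * (1 - v) * ((1 - u) * (1 - v)) * (1 - v ^ 2))"
    unfolding two prod.lessThan_Suc A_def sgn pow
    by (simp only: diff_minus_eq_add mult_ac)
  also have "(1 + u) * (1 - v) * ((1 - u) * (1 - v)) * (1 - v ^ 2) =
      (1 - v) ^ 2 * ((1 - u ^ 2) * (1 - v ^ 2))"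
    by (simp add: power2_eq_square algebra_simps)
  also have "A = (\<Prod>i<n. 1 - (q ^ 2) ^ Suc i) ^ 2 * (\<Prod>i<2 * n. 1 - (q ^ 2) ^ Suc i)"
    unfolding A_def by (rule Suc.IH)
  finally show ?case
    unfolding two prod.lessThan_Suc pow power_mult_distrib by (simp only: mult_ac)
qed simp

lemma euler_f_nonzero: "m > 0 \<Longrightarrow> euler_f m \<noteq> 0"
  by (metis euler_f_has_prod(2) fps_zero_nth zero_neq_one)

text \<open>By \<open>agree_theta\<close> at \<open>-X\<close>, \<open>phi 1 * euler_f 2\<close> is
  \<open>f_1(-q)^2\<close>, which \<open>prod_odd_even_factors\<close> relates to
  \<open>f_1\<close>, \<open>f_2\<close> and \<open>f_4\<close>. Gauss' product at 1 and 2 then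
  introduces the other two theta series, and the Euler products cancel.\<close>

lemma phi_mult_phi_minus: "phi 1 * phi_minus 1 = phi_minus 2 ^ 2"
proof -
  have "phi 1 * euler_f 2 * euler_f 1 ^ 2 * euler_f 4 ^ 2 = euler_f 2 ^ 6"
  proof (rule agree_eqI)
    fix n
    define N where "N = Suc n"
    \<comment> \<open>Substituting \<open>-X\<close> makes all signs of the alternating theta series
      positive.\<close>
    define q :: "int fps" where "q = - fps_X"
    have euler: "agree n (\<Prod>i<K. 1 - ((- q) ^ m) ^ Suc i) (euler_f m)" if "m > 0" "K \<ge> N" for m K
      unfolding q_def minus_minus using that by (intro agree_sym [OF agree_euler_f]) (simp_all add: N_def)
    have "(-1) ^ Suc s * q ^ (Suc s)\<^sup>2 = fps_X ^ (1 * (Suc s)\<^sup>2)" for s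
      by (cases "even s") (simp_all add: q_def)
    hence "agree n (phi 1) (1 + 2 * (\<Sum>s<2 * N. (-1) ^ Suc s * q ^ (Suc s)\<^sup>2))"
      using agree_phi[of 1 n "2 * N"] by (simp add: N_def)
    moreover have "agree n (euler_f 2) (\<Prod>i<2 * N. 1 - (q ^ 2) ^ Suc i)"
      using agree_euler_f[of 2 n "2 * N"] by (simp add: q_def N_def)
    ultimately have "agree n (phi 1 * euler_f 2)
       ((1 + 2 * (\<Sum>s<2 * N. (-1) ^ Suc s * q ^ (Suc s)\<^sup>2)) * (\<Prod>i<2 * N. 1 - (q ^ 2) ^ Suc i))"
      by (rule agree_mult)
    also have "agree n \<dots> ((\<Prod>i<2 * N. 1 - q ^ Suc i) ^ 2)"
      by (intro agree_mono [OF agree_theta]) (simp_all add: q_def N_def)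
    finally have phi: "agree n (phi 1 * euler_f 2) ((\<Prod>i<2 * N. 1 - q ^ Suc i) ^ 2)" .
    have "agree n (phi 1 * euler_f 2 * euler_f 1 ^ 2 * euler_f 4 ^ 2)
       ((\<Prod>i<2 * N. 1 - q ^ Suc i) ^ 2 * (\<Prod>i<2 * N. 1 - ((- q) ^ 1) ^ Suc i) ^ 2 *
         (\<Prod>i<N. 1 - ((- q) ^ 4) ^ Suc i) ^ 2)"
      by (rule agree_mult [OF agree_mult [OF phi agree_power [OF agree_sym [OF euler]]]
            agree_power [OF agree_sym [OF euler]]]) simp_all
    also have "\<dots> = ((\<Prod>i<N. 1 - ((- q) ^ 2) ^ Suc i) ^ 2 * (\<Prod>i<2 * N. 1 - ((- q) ^ 2) ^ Suc i)) ^ 2"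
      using prod_odd_even_factors[of "- q" N] by (simp only: power_mult_distrib [symmetric] minus_minus power_one_right)
    also have "agree n \<dots> ((euler_f 2 ^ 2 * euler_f 2) ^ 2)"
      by (rule agree_power [OF agree_mult [OF agree_power [OF euler] euler]]) simp_all
    also have "(euler_f 2 ^ 2 * euler_f 2) ^ 2 = euler_f 2 ^ 6"
      by (simp only: power_mult_distrib power_mult [symmetric] power_add [symmetric]) simp
    finally show "agree n (phi 1 * euler_f 2 * euler_f 1 ^ 2 * euler_f 4 ^ 2) (euler_f 2 ^ 6)" .
  qed
  also have "euler_f 2 ^ 6 = euler_f 2 ^ 2 * (euler_f 2 ^ 2) ^ 2"
    by (simp only: power_mult [symmetric] power_add [symmetric]) simp
  also have "\<dots> = phi_minus 2 ^ 2 * (euler_f 2 ^ 2 * euler_f 4 ^ 2)"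
    using euler_f_square[of 2] by (simp add: power_mult_distrib)
  also have "phi 1 * euler_f 2 * euler_f 1 ^ 2 * euler_f 4 ^ 2 =
      phi 1 * euler_f 2 * (euler_f 2 * phi_minus 1) * euler_f 4 ^ 2"
    using euler_f_square[of 1] by simp
  also have "\<dots> = phi 1 * phi_minus 1 * (euler_f 2 ^ 2 * euler_f 4 ^ 2)"
    by (simp add: power2_eq_square mult_ac)
  finally have "phi 1 * phi_minus 1 * (euler_f 2 ^ 2 * euler_f 4 ^ 2) =
      phi_minus 2 ^ 2 * (euler_f 2 ^ 2 * euler_f 4 ^ 2)" .
  thus ?thesis by (simp add: euler_f_nonzero)
qed

subsection \<open>Residue classes of exponents\<close>

text \<open>\<open>M = 0\<close> says that \<open>F\<close> is exactly a series in
  \<open>q^m\<close>, since 0 divides only 0.\<close>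

definition dissected :: "int \<Rightarrow> nat \<Rightarrow> int fps \<Rightarrow> bool" where
  "dissected M m F \<longleftrightarrow> (\<forall>n. \<not> m dvd n \<longrightarrow> M dvd fps_nth F n)"

definition vanishes :: "int \<Rightarrow> nat \<Rightarrow> nat \<Rightarrow> int fps \<Rightarrow> bool" where
  "vanishes M m r F \<longleftrightarrow> (\<forall>n. n mod m = r mod m \<longrightarrow> M dvd fps_nth F n)"

lemma dissected_add: "dissected M m F \<Longrightarrow> dissected M m G \<Longrightarrow> dissected M m (F + G)"
  by (simp add: dissected_def)

lemma dissected_diff: "dissected M m F \<Longrightarrow> dissected M m G \<Longrightarrow> dissected M m (F - G)"
  by (simp add: dissected_def)

lemma dissected_const: "dissected M m (fps_const c)"
  by (auto simp: dissected_def)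

lemma dissected_1: "dissected M m 1"
  using dissected_const[of M m 1] by simp

lemma dissected_numeral: "dissected M m (numeral k)"
  using dissected_const[of M m "numeral k"] by (simp add: numeral_fps_const)

lemma dissected_X_power: "m dvd k \<Longrightarrow> dissected M m (fps_X ^ k)"
  by (auto simp: dissected_def fps_X_power_iff)

lemma dissected_mult:
  assumes "dissected M m F" "dissected M m G"
  shows "dissected M m (F * G)"
  unfolding dissected_def
proof safe
  fix n assume n: "\<not> m dvd n"
  have "M dvd fps_nth F i * fps_nth G (n - i)" if "i \<le> n" for i
  proof (cases "m dvd i")
    case True
    hence "\<not> m dvd n - i"
      using n that by (metis dvd_add le_add_diff_inverse)
    thus ?thesis using assms(2) by (simp add: dissected_def)
  qed (use assms(1) in \<open>simp add: dissected_def\<close>)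
  thus "M dvd fps_nth (F * G) n"
    unfolding fps_mult_nth by (intro dvd_sum) simp
qed

lemma dissected_power: "dissected M m F \<Longrightarrow> dissected M m (F ^ k)"
  by (induction k) (auto intro: dissected_mult dissected_1)

lemma dissected_mono: "dissected M m F \<Longrightarrow> M' dvd M \<Longrightarrow> m' dvd m \<Longrightarrow> dissected M' m' F"
  unfolding dissected_def by (meson dvd_trans)

lemma dissected_weaken: "dissected 0 m F \<Longrightarrow> dissected M m F"
  by (erule dissected_mono) simp_all

lemma dissected_add_multiple:
  assumes "dissected 0 m F"
  shows "dissected M m (F + fps_const M * G)"
  using assms by (simp add: dissected_def)

lemma dissected_lacunary:
  assumes "\<And>s. m dvd e s"
  shows "dissected 0 m (lacunary e)"
  using assms by (auto simp: dissected_def lacunary_def fps_sum_nth fps_X_power_iff intro!: sum.neutral)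

lemma dissected_phi: "dissected 0 m (phi m)"
  unfolding phi_def by (intro dissected_add dissected_mult dissected_1 dissected_numeral dissected_lacunary) simp

lemma dissected_psi: "dissected 0 m (psi m)"
  unfolding psi_def by (intro dissected_lacunary) simp

lemma dissected_euler_f:
  assumes "m > 0"
  shows "dissected 0 m (euler_f m)"
  unfolding dissected_def
proof safe
  fix n assume n: "\<not> m dvd n"
  have "dissected 0 m (\<Prod>i<k. 1 - (fps_X ^ m) ^ Suc i)" for k
    by (induction k)
       (auto simp del: power_Suc intro!: dissected_1 dissected_mult dissected_diff dissected_power dissected_X_power)
  thus "0 dvd fps_nth (euler_f m) n"
    using agree_euler_f[OF assms, of n n] n by (simp add: dissected_def agree_def)
qed

lemma dissected_imp_vanishes: "dissected M m F \<Longrightarrow> \<not> m dvd r \<Longrightarrow> vanishes M m r F"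
  unfolding dissected_def vanishes_def by (metis mod_0_imp_dvd dvd_imp_mod_0)

lemma vanishes_const_mult:
  assumes "vanishes M m r F" "M' dvd c * M"
  shows "vanishes M' m r (fps_const c * F)"
  using assms by (auto simp: vanishes_def intro: dvd_trans[OF _ mult_dvd_mono])

lemma vanishes_const_mult_trivial: "M dvd c \<Longrightarrow> vanishes M m r (fps_const c * F)"
  by (simp add: vanishes_def)

lemma vanishes_X_power_mult:
  assumes "vanishes M m r F"
  shows "vanishes M m (r + i) (fps_X ^ i * F)"
  unfolding vanishes_def
proof safe
  fix n assume n: "n mod m = (r + i) mod m"
  show "M dvd fps_nth (fps_X ^ i * F) n"
  proof (cases "n < i")
    case False
    have "[n - i + i = r + i] (mod m)"
      using n False by (simp add: cong_def)
    hence "(n - i) mod m = r mod m"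
      unfolding cong_add_rcancel_nat by (simp add: cong_def)
    thus ?thesis
      using assms False by (simp add: vanishes_def fps_X_power_mult_nth)
  qed (simp add: fps_X_power_mult_nth)
qed

text \<open>The factor \<^term>\<open>E\<close> only has to be dissected modulo \<^term>\<open>M'\<close> where \<^term>\<open>D\<close> already supplies
  the factor \<^term>\<open>M\<close>.\<close>

lemma dvd_mult_term:
  assumes "vanishes M m r D" "dissected (M * M') m E" "dissected M' k E"
    and "n mod m = r mod m" "i \<le> n" "\<not> k dvd n - i"
  shows "M * M' dvd fps_nth D i * fps_nth E (n - i)"
proof (cases "m dvd n - i")
  case True
  hence "i mod m = r mod m"
    using assms(4,5) by (simp add: mod_eq_dvd_iff_nat [symmetric])
  thus ?thesis
    using assms(1,3,6) by (intro mult_dvd_mono) (simp_all add: vanishes_def dissected_def)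
next
  case False
  thus ?thesis using assms(2) by (simp add: dissected_def)
qed

text \<open>Strong induction on the exponent: as \<open>E\<close> starts with 1, the coefficient of
  \<open>D * E\<close> isolates that of \<open>D\<close>, and each other product is covered by the
  induction hypothesis or by \<open>dvd_mult_term\<close>. This gains \<open>M'\<close> on a finer
  progression although \<open>E\<close> is a series in \<open>q^k\<close> only modulo
  \<open>M'\<close>.\<close>

lemma vanishes_cancel_refined:
  assumes "vanishes M m r D" "dissected (M * M') m E" "dissected M' k E"
    and "fps_nth E 0 = 1" "m dvd k" "s mod m = r mod m"
    and DE: "vanishes (M * M') k s (D * E)"
  shows "vanishes (M * M') k s D"
proof -
  have "n mod k = s mod k \<longrightarrow> M * M' dvd fps_nth D n" for n
  proof (induction n rule: less_induct)
    case (less n)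
    show ?case
    proof
      assume n: "n mod k = s mod k"
      hence nm: "n mod m = r mod m"
        using assms(5,6) by (metis mod_mod_cancel)
      have "M * M' dvd fps_nth D i * fps_nth E (n - i)" if "i < n" for i
      proof (cases "k dvd n - i")
        case True
        hence "i mod k = n mod k"
          using that by (simp add: mod_eq_dvd_iff_nat [symmetric])
        thus ?thesis
          using less[of i] that n by simp
      qed (use that nm assms in \<open>auto intro: dvd_mult_term\<close>)
      hence "M * M' dvd (\<Sum>i<n. fps_nth D i * fps_nth E (n - i))"
        by (intro dvd_sum) simp
      moreover have "M * M' dvd fps_nth (D * E) n"
        using DE n by (simp add: vanishes_def)
      moreover have "fps_nth (D * E) n = (\<Sum>i<n. fps_nth D i * fps_nth E (n - i)) + fps_nth D n"
        using assms(4) by (simp add: fps_mult_nth atLeast0AtMost flip: lessThan_Suc_atMost)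
      ultimately show "M * M' dvd fps_nth D n"
        by (simp add: dvd_add_right_iff)
    qed
  qed
  thus ?thesis by (simp add: vanishes_def)
qed

lemma vanishes_cancel:
  assumes "dissected M m E" "fps_nth E 0 = 1" "vanishes M m r (D * E)"
  shows "vanishes M m r D"
  \<comment> \<open>With \<open>M = 1\<close> and \<open>m = 1\<close> the preliminary divisibility
    of \<open>D\<close> is trivial.\<close>
  using vanishes_cancel_refined[of 1 1 0 D M E m r] assms by (simp add: vanishes_def dissected_def)

lemma vanishes_mult:
  assumes "vanishes M m r D" "dissected M m E"
  shows "vanishes M m r (D * E)"
  unfolding vanishes_def
proof safe
  fix n assume n: "n mod m = r mod m"
  have "M dvd fps_nth D i * fps_nth E (n - i)" if "i \<le> n" for i
  proof (cases "m dvd n - i")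
    case True
    hence "i mod m = n mod m"
      using that by (simp add: mod_eq_dvd_iff_nat [symmetric])
    thus ?thesis using assms(1) n by (simp add: vanishes_def)
  qed (use assms(2) in \<open>simp add: dissected_def\<close>)
  thus "M dvd fps_nth (D * E) n"
    unfolding fps_mult_nth by (intro dvd_sum) simp
qed

subsection \<open>Binomial expansions\<close>

text \<open>Since \<open>a^2 - 1 = (a - 1) ((a - 1) + 2)\<close>, each squaring gains a factor 2;
  six squarings give the modulus 128.\<close>

lemma two_power_dvd_power_diff_1:
  fixes a :: "'a :: comm_ring_1"
  assumes "2 dvd a - 1"
  shows "2 ^ Suc k dvd a ^ 2 ^ k - 1"
proof (induction k)
  case (Suc k)
  have "2 dvd a ^ 2 ^ k - 1"
    using Suc by (rule dvd_trans [rotated]) simp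
  hence "2 dvd (a ^ 2 ^ k - 1) + 2"
    by (rule dvd_add) simp
  hence "2 ^ Suc k * 2 dvd (a ^ 2 ^ k - 1) * ((a ^ 2 ^ k - 1) + 2)"
    by (intro mult_dvd_mono Suc)
  thus ?case
    by (simp add: power_mult power2_eq_square algebra_simps)
qed (use assms in simp)

lemma dvd_mult_diff_1:
  fixes a b c :: "'a :: comm_ring_1"
  assumes "c dvd a - 1" "c dvd b - 1"
  shows "c dvd a * b - 1"
proof -
  have "a * b - 1 = (a - 1) * b + (b - 1)"
    by (simp add: algebra_simps)
  thus ?thesis using assms by (metis dvd_add dvd_mult2)
qed

lemma dvd_power_diff_1:
  fixes a c :: "'a :: comm_ring_1"
  assumes "c dvd a - 1"
  shows "c dvd a ^ k - 1"
  by (induction k) (use assms in \<open>auto intro: dvd_mult_diff_1\<close>)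

lemma homogeneous_expansion_step:
  fixes W x :: "'a :: comm_ring_1" and e :: "nat \<Rightarrow> int"
  assumes "\<And>i. i > N \<Longrightarrow> e i = 0"
  shows "(W + of_int c * x) * (\<Sum>i\<le>N. of_int (e i) * W ^ (N - i) * x ^ i) =
    (\<Sum>i\<le>Suc N. of_int (e i + c * (if i = 0 then 0 else e (i - 1))) * W ^ (Suc N - i) * x ^ i)"
proof -
  have "(\<Sum>i\<le>Suc N. of_int (e i + c * (if i = 0 then 0 else e (i - 1))) * W ^ (Suc N - i) * x ^ i) =
      (\<Sum>i\<le>Suc N. of_int (e i) * W ^ (Suc N - i) * x ^ i) +
      (\<Sum>i\<le>Suc N. of_int (c * (if i = 0 then 0 else e (i - 1))) * W ^ (Suc N - i) * x ^ i)"
    by (simp only: of_int_add distrib_right sum.distrib)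
  also have "(\<Sum>i\<le>Suc N. of_int (e i) * W ^ (Suc N - i) * x ^ i) =
      (\<Sum>i\<le>N. W * (of_int (e i) * W ^ (N - i) * x ^ i))"
    using assms[of "Suc N"] by (simp add: Suc_diff_le mult_ac)
  also have "(\<Sum>i\<le>Suc N. of_int (c * (if i = 0 then 0 else e (i - 1))) * W ^ (Suc N - i) * x ^ i) =
      (\<Sum>i\<le>N. of_int c * x * (of_int (e i) * W ^ (N - i) * x ^ i))"
    by (subst sum.atMost_Suc_shift) (simp add: mult_ac)
  finally show ?thesis
    by (simp only: distrib_right sum_distrib_left sum.distrib)
qed

text \<open>\<open>e i\<close> is the \<open>i\<close>-th elementary symmetric function of
  \<open>a\<close> copies of -1 and \<open>b\<close> copies of 1. Their power sums are
  \<open>p1 = p3 = b - a\<close> and \<open>p2 = a + b\<close>, so the two formulas are Newton's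
  identities. They are proved by adding one linear factor at a time.\<close>

lemma homogeneous_expansion:
  fixes W x :: "'a :: comm_ring_1"
  obtains e :: "nat \<Rightarrow> int" where
    "(W - x) ^ a * (W + x) ^ b = (\<Sum>i\<le>a + b. of_int (e i) * W ^ (a + b - i) * x ^ i)"
    "2 * e 2 = (int b - int a)\<^sup>2 - int (a + b)"
    "6 * e 3 = (int b - int a) ^ 3 - 3 * (int b - int a) * int (a + b) + 2 * (int b - int a)"
proof -
  \<comment> \<open>\<open>e 0\<close>, \<open>e 1\<close> and the zero tail belong to the invariant
    because the recursion for \<open>e 3\<close> descends to \<open>e 0\<close> and the step lemma
    needs the tail.\<close>
  define good where "good = (\<lambda>F N (d :: int) (e :: nat \<Rightarrow> int). F = (\<Sum>i\<le>N. of_int (e i) * W ^ (N - i) * x ^ i) \<and>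
    (\<forall>i>N. e i = 0) \<and> e 0 = 1 \<and> e 1 = d \<and> 2 * e 2 = d\<^sup>2 - int N \<and>
    6 * e 3 = d ^ 3 - 3 * d * int N + 2 * d)"
  have step: "\<exists>e'. good ((W + of_int c * x) * F) (Suc N) (d + c) e'"
    if good: "good F N d e" and c: "c \<in> {1, -1}" for F N d e c
  proof -
    define e' where "e' = (\<lambda>i. e i + c * (if i = 0 then 0 else e (i - 1)))"
    have "(W + of_int c * x) * F = (\<Sum>i\<le>Suc N. of_int (e' i) * W ^ (Suc N - i) * x ^ i)"
      using good unfolding e'_def good_def by (subst homogeneous_expansion_step [symmetric]) auto
    moreover have "e' 0 = 1" "e' 1 = d + c"
      using good by (simp_all add: e'_def good_def)
    moreover have "2 * e' 2 = (d + c)\<^sup>2 - int (Suc N)"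
      using good c by (auto simp: e'_def good_def power2_eq_square algebra_simps)
    moreover have "6 * e' 3 = (d + c) ^ 3 - 3 * (d + c) * int (Suc N) + 2 * (d + c)"
    proof -
      have "6 * e' 3 = 6 * e 3 + 3 * c * (2 * e 2)"
        by (simp add: e'_def)
      also have "\<dots> = d ^ 3 - 3 * d * int N + 2 * d + 3 * c * (d\<^sup>2 - int N)"
        using good by (simp add: good_def)
      also have "\<dots> = (d + c) ^ 3 - 3 * (d + c) * int (Suc N) + 2 * (d + c)"
        using c by (auto simp: power2_eq_square power3_eq_cube algebra_simps)
      finally show ?thesis .
    qed
    moreover have "\<forall>i>Suc N. e' i = 0"
      using good by (auto simp: e'_def good_def)
    ultimately show ?thesis
      unfolding good_def by blast
  qed
  have minus: "\<exists>e. good ((W - x) ^ a) a (- int a) e"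
  proof (induction a)
    case 0
    have "good 1 0 0 (\<lambda>i. if i = 0 then 1 else 0)"
      by (simp add: good_def)
    thus ?case by auto
  next
    case (Suc a)
    then obtain e where "good ((W - x) ^ a) a (- int a) e" ..
    from step[OF this, of "-1"] show ?case
      by (simp add: minus_diff_commute)
  qed
  have "\<exists>e. good ((W - x) ^ a * (W + x) ^ b) (a + b) (int b - int a) e"
  proof (induction b)
    case 0
    show ?case using minus by simp
  next
    case (Suc b)
    then obtain e where "good ((W - x) ^ a * (W + x) ^ b) (a + b) (int b - int a) e" ..
    from step[OF this, of 1] show ?case
      by (simp add: mult_ac add_ac add_diff_eq)
  qed
  thus thesis using that by (auto simp: good_def)
qed

subsection \<open>Theta expansion of the generating function\<close>

text \<open>Multiplying by \<^term>\<open>(phi_minus 4 * phi 4) ^ m\<close> rather than by \<^term>\<open>phi_minus 4 ^ m\<close> keeps the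
  factor beside \<^term>\<open>diamond_gf (8 * m - 1)\<close> a series in \<open>q\<^sup>8\<close>.\<close>

definition cofactor :: "nat \<Rightarrow> int fps" where
  "cofactor m = euler_f 8 ^ m * (phi_minus 4 * phi 4) ^ m"

text \<open>For \<open>k = 8j+7\<close>, Gauss' product makes \<open>f_1^(3k+1)\<close> contain
  \<open>f_2^((3k+1)/2)\<close>. Since \<open>(3k+1)/2 - k = (k+1)/2 = 4(j+1)\<close>, cancelling
  \<open>f_2^k\<close> leaves fourth powers of \<open>f_2\<close>, which reduce further to
  \<open>f_8\<close>.\<close>

lemma diamond_gf_theta:
  "diamond_gf (8 * j + 7) * (euler_f 8 * phi_minus 4 * phi 1) ^ Suc j * phi_minus 1 ^ (13 * j + 12) = 1"
proof -
  define D where "D = diamond_gf (8 * j + 7)"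
  have "D * (euler_f 1 ^ 2) ^ (12 * j + 11) = euler_f 2 ^ (8 * j + 7)"
  proof -
    have "3 * (8 * j + 7) + 1 = 2 * (12 * j + 11)"
      by simp
    thus ?thesis
      using diamond_gf_mult[of "8 * j + 7"] by (simp only: D_def power_mult [symmetric])
  qed
  also have "euler_f 1 ^ 2 = euler_f 2 * phi_minus 1"
    using euler_f_square[of 1] by simp
  also have "(euler_f 2 * phi_minus 1) ^ (12 * j + 11) =
      euler_f 2 ^ (8 * j + 7) * (((euler_f 2 ^ 2) ^ 2) ^ Suc j * phi_minus 1 ^ (12 * j + 11))"
  proof -
    have "12 * j + 11 = 8 * j + 7 + 2 * 2 * Suc j"
      by simp
    hence "euler_f 2 ^ (12 * j + 11) = euler_f 2 ^ (8 * j + 7) * ((euler_f 2 ^ 2) ^ 2) ^ Suc j"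
      by (simp only: power_add power_mult)
    thus ?thesis
      by (simp only: power_mult_distrib mult.assoc)
  qed
  also have "(euler_f 2 ^ 2) ^ 2 = euler_f 4 ^ 2 * phi_minus 2 ^ 2"
    using euler_f_square[of 2] by (simp add: power_mult_distrib)
  also have "\<dots> = euler_f 8 * phi_minus 4 * phi 1 * phi_minus 1"
    using euler_f_square[of 4] phi_mult_phi_minus by (simp add: mult_ac)
  also have "(euler_f 8 * phi_minus 4 * phi 1 * phi_minus 1) ^ Suc j * phi_minus 1 ^ (12 * j + 11) =
      (euler_f 8 * phi_minus 4 * phi 1) ^ Suc j * phi_minus 1 ^ (13 * j + 12)"
  proof -
    have "13 * j + 12 = Suc j + (12 * j + 11)"
      by simp
    thus ?thesis
      by (simp only: power_mult_distrib power_add mult.assoc)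
  qed
  finally have "euler_f 2 ^ (8 * j + 7) *
      (D * ((euler_f 8 * phi_minus 4 * phi 1) ^ Suc j * phi_minus 1 ^ (13 * j + 12))) =
      euler_f 2 ^ (8 * j + 7) * 1"
    by (simp only: mult_ac mult_1 mult_1_right)
  hence "D * ((euler_f 8 * phi_minus 4 * phi 1) ^ Suc j * phi_minus 1 ^ (13 * j + 12)) = 1"
    unfolding mult_left_cancel [OF power_not_zero [OF euler_f_nonzero [of 2, simplified]]] .
  thus ?thesis by (simp only: D_def mult.assoc)
qed

lemma phi_minus_1: "phi_minus 1 = phi 4 - 2 * fps_X * psi 8"
  by (simp add: phi_minus_def)

lemma phi_1: "phi 1 = phi 4 + 2 * fps_X * psi 8"
  using phi_dissection[of 1] by simp

lemma phi_4: "phi 4 = phi 16 + 2 * fps_X ^ 4 * psi 32"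
  using phi_dissection[of 4] by simp

lemma phi_minus_4: "phi_minus 4 = phi 16 - 2 * fps_X ^ 4 * psi 32"
  by (simp add: phi_minus_def)

text \<open>The exponents \<open>51j+52\<close> and \<open>63j+63\<close> complete
  \<open>13j+12\<close> and \<open>j+1\<close> to \<open>64(j+1)\<close>, and 64-th powers are 1
  modulo 128. The inverse powers thus become positive ones.\<close>

lemma diamond_gf_cofactor_dvd:
  "128 dvd diamond_gf (8 * j + 7) * cofactor (Suc j) -
    phi 4 ^ Suc j * (phi_minus 1 ^ (51 * j + 52) * phi 1 ^ (63 * j + 63))"
proof -
  define D where "D = diamond_gf (8 * j + 7)"
  have "2 dvd phi m - 1" for m
    by (simp add: phi_def)
  moreover have "2 dvd phi_minus 1 - 1"
  proof -
    have "phi_minus 1 - 1 = 2 * (lacunary (\<lambda>s. 4 * (Suc s)\<^sup>2) - fps_X * psi 8)"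
      unfolding phi_minus_1 by (simp add: phi_def right_diff_distrib mult.assoc)
    thus ?thesis by simp
  qed
  ultimately have "2 ^ Suc 6 dvd (phi 1 ^ 2 ^ 6) ^ Suc j * (phi_minus 1 ^ 2 ^ 6) ^ Suc j - 1"
    by (intro dvd_mult_diff_1 dvd_power_diff_1 two_power_dvd_power_diff_1)
  hence dvd: "128 dvd phi 1 ^ (64 * Suc j) * phi_minus 1 ^ (64 * Suc j) - 1"
    by (simp only: power_mult [symmetric]) simp
  define U where "U = phi 4 ^ Suc j * (phi_minus 1 ^ (51 * j + 52) * phi 1 ^ (63 * j + 63))"
  have "U = D * (euler_f 8 * phi_minus 4 * phi 1) ^ Suc j * phi_minus 1 ^ (13 * j + 12) * U"
    using diamond_gf_theta[of j] by (simp only: D_def mult_1)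
  also have "\<dots> = D * cofactor (Suc j) *
      ((phi 1 ^ Suc j * phi 1 ^ (63 * j + 63)) * (phi_minus 1 ^ (13 * j + 12) * phi_minus 1 ^ (51 * j + 52)))"
    unfolding U_def cofactor_def power_mult_distrib by (simp only: mult_ac)
  also have "\<dots> = D * cofactor (Suc j) * (phi 1 ^ (64 * Suc j) * phi_minus 1 ^ (64 * Suc j))"
    unfolding power_add [symmetric] by (simp add: algebra_simps)
  finally have "D * cofactor (Suc j) - U =
      - (D * cofactor (Suc j) * (phi 1 ^ (64 * Suc j) * phi_minus 1 ^ (64 * Suc j) - 1))"
    by (simp only: right_diff_distrib mult_1_right minus_diff_eq)
  thus ?thesis
    unfolding D_def U_def using dvd by (metis dvd_minus_iff dvd_mult)
qed

text \<open>The term in \<open>x^i\<close>: \<open>114 * m + 1\<close> is the degree of the form in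
  \<open>W\<close> and \<open>x\<close>, and the final \<open>+ m\<close> comes from the factor
  \<open>phi 4 ^ m\<close>.\<close>

definition theta_term :: "(nat \<Rightarrow> int) \<Rightarrow> nat \<Rightarrow> nat \<Rightarrow> int fps" where
  "theta_term e m i =
    fps_const (2 ^ i * e i) * (fps_X ^ i * (psi 8 ^ i * phi 4 ^ (114 * m + 1 - i + m)))"

text \<open>Newton's formulas with \<open>b - a = 12j+11\<close> and
  \<open>a + b = 114j+115\<close>. The common factor \<open>j + 1\<close> supplies the extra powers
  of 2 when \<open>j\<close> is odd.\<close>

lemma diamond_gf_expansion:
  obtains e :: "nat \<Rightarrow> int" where
    "e 2 = 3 * (int j + 1) * (24 * int j + 1)"
    "e 3 = (int j + 1) * (12 * int j + 11) * (24 * int j - 37)"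
    "128 dvd diamond_gf (8 * j + 7) * cofactor (Suc j) - (\<Sum>i\<le>114 * Suc j + 1. theta_term e (Suc j) i)"
proof -
  obtain e where e: "(phi 4 - 2 * fps_X * psi 8) ^ (51 * j + 52) * (phi 4 + 2 * fps_X * psi 8) ^ (63 * j + 63) =
      (\<Sum>i\<le>51 * j + 52 + (63 * j + 63). of_int (e i) * phi 4 ^ (51 * j + 52 + (63 * j + 63) - i) * (2 * fps_X * psi 8) ^ i)"
    and e2: "2 * e 2 = (int (63 * j + 63) - int (51 * j + 52))\<^sup>2 - int (51 * j + 52 + (63 * j + 63))"
    and e3: "6 * e 3 = (int (63 * j + 63) - int (51 * j + 52)) ^ 3 -
      3 * (int (63 * j + 63) - int (51 * j + 52)) * int (51 * j + 52 + (63 * j + 63)) +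
      2 * (int (63 * j + 63) - int (51 * j + 52))"
    by (rule homogeneous_expansion)
  have s: "51 * j + 52 + (63 * j + 63) = 114 * Suc j + 1"
    by simp
  have "2 * e 2 = 2 * (3 * (int j + 1) * (24 * int j + 1))"
    unfolding e2 by (simp add: power2_eq_square algebra_simps)
  hence "e 2 = 3 * (int j + 1) * (24 * int j + 1)"
    by simp
  moreover have "6 * e 3 = 6 * ((int j + 1) * (12 * int j + 11) * (24 * int j - 37))"
    unfolding e3 by (simp add: power3_eq_cube algebra_simps)
  hence "e 3 = (int j + 1) * (12 * int j + 11) * (24 * int j - 37)"
    by simp
  moreover have "phi 4 ^ Suc j * (phi_minus 1 ^ (51 * j + 52) * phi 1 ^ (63 * j + 63)) =
      (\<Sum>i\<le>114 * Suc j + 1. theta_term e (Suc j) i)"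
  proof -
    have summand: "phi 4 ^ Suc j * (of_int (e i) * phi 4 ^ (114 * Suc j + 1 - i) * (2 * fps_X * psi 8) ^ i) =
        theta_term e (Suc j) i" for i
    proof -
      have "fps_const (2 ^ i * e i) = 2 ^ i * of_int (e i)"
        by (simp only: fps_of_int [symmetric] of_int_eq_id id_apply numeral_fps_const
            fps_const_mult [symmetric] fps_const_power [symmetric])
      thus ?thesis
        unfolding theta_term_def power_add power_mult_distrib by (simp only: mult_ac)
    qed
    show ?thesis
      unfolding phi_minus_1 phi_1 e s sum_distrib_left summand ..
  qed
  hence "128 dvd diamond_gf (8 * j + 7) * cofactor (Suc j) - (\<Sum>i\<le>114 * Suc j + 1. theta_term e (Suc j) i)"
    using diamond_gf_cofactor_dvd[of j] by simp
  ultimately show thesis by (rule that)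
qed

section \<open>Theta factors modulo 2 and 4\<close>

text \<open>In \<open>phi 16 + 2 q^4 psi 32\<close> the second summand drops out modulo 2; after
  squaring, both new terms carry a 4.\<close>

lemma dissected_phi_4: "dissected 0 4 (phi 4)" "dissected 2 16 (phi 4)" "dissected 4 8 (phi 4 ^ 2)"
proof -
  show "dissected 0 4 (phi 4)"
    by (rule dissected_phi)
  show "dissected 2 16 (phi 4)"
    using dissected_add_multiple[OF dissected_phi[of 16], of 2 "fps_X ^ 4 * psi 32"]
    by (simp add: phi_4 numeral_fps_const mult.assoc)
  have "dissected 0 8 (phi 16 ^ 2)"
    by (intro dissected_power dissected_mono [OF dissected_phi]) simp_all
  moreover have "phi 4 ^ 2 = phi 16 ^ 2 + fps_const 4 * (fps_X ^ 4 * psi 32 * phi 16 + (fps_X ^ 4 * psi 32) ^ 2)"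
    unfolding phi_4 by (simp add: numeral_fps_const [symmetric] power2_eq_square algebra_simps)
  ultimately show "dissected 4 8 (phi 4 ^ 2)"
    using dissected_add_multiple by simp
qed

text \<open>A difference of squares: the terms in odd powers of \<open>q^4\<close> cancel.\<close>

lemma dissected_phi_4_mult_minus: "dissected 0 8 (phi_minus 4 * phi 4)" "dissected 2 16 (phi_minus 4 * phi 4)"
proof -
  have eq: "phi_minus 4 * phi 4 = phi 16 ^ 2 - 4 * fps_X ^ 8 * psi 32 ^ 2"
  proof -
    have "fps_X ^ 8 = (fps_X ^ 4 * fps_X ^ 4 :: int fps)"
      by (simp flip: power_add)
    thus ?thesis
      unfolding phi_4 phi_minus_4 by (simp only: power2_eq_square) (simp add: algebra_simps)
  qed
  show "dissected 0 8 (phi_minus 4 * phi 4)"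
    unfolding eq
    by (intro dissected_diff dissected_mult dissected_numeral dissected_X_power dissected_power
        dissected_mono [OF dissected_phi] dissected_mono [OF dissected_psi]) simp_all
  have "phi_minus 4 * phi 4 = phi 16 ^ 2 + fps_const 2 * (- (2 * fps_X ^ 8 * psi 32 ^ 2))"
    unfolding eq by (simp add: numeral_fps_const [symmetric])
  thus "dissected 2 16 (phi_minus 4 * phi 4)"
    by (simp only: dissected_add_multiple dissected_power dissected_phi)
qed

lemma dissected_cofactor: "dissected 0 8 (cofactor m)"
  unfolding cofactor_def
  by (intro dissected_mult dissected_power dissected_euler_f dissected_phi_4_mult_minus) simp

lemma cofactor_nth_0: "fps_nth (cofactor m) 0 = 1"
proof -
  have "fps_nth (phi k) 0 = 1" if "k > 0" for k
    using agree_phi[of k 0 1] that by (simp add: agree_def power2_eq_square)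
  thus ?thesis
    by (simp add: cofactor_def phi_minus_def fps_nth_power_0 euler_f_has_prod(2))
qed

text \<open>Reduces a residue class to a single theta term. The extra factor \<open>G\<close> allows
  multiplication by Euler products before the cofactor is cancelled.\<close>

lemma vanishes_diamond_gf_mult:
  assumes "4 dvd \<mu>" "i < 4" "r mod 4 = i" "M dvd 128" "M dvd 2 ^ (i + 4)"
    and "128 dvd D - (\<Sum>i\<le>N. theta_term e m i)"
    and "dissected 0 4 G" "vanishes M \<mu> r (theta_term e m i * G)"
  shows "vanishes M \<mu> r (D * G)"
  unfolding vanishes_def
proof safe
  fix n assume n: "n mod \<mu> = r mod \<mu>"
  hence n4: "n mod 4 = i"
    using assms(1,3) by (metis mod_mod_cancel)
  have "M dvd fps_nth (theta_term e m k * G) n" for k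
  proof (cases "k = i")
    case False
    show ?thesis
    proof (cases "k mod 4 = i")
      case True
      \<comment> \<open>The next index in the same class already contributes
        \<open>2 ^ (i + 4)\<close>.\<close>
      hence "k \<ge> i + 4"
        using True False assms(2) by presburger
      hence "M dvd 2 ^ k"
        using assms(5) by (meson dvd_trans le_imp_power_dvd)
      thus ?thesis
        by (simp add: theta_term_def mult.assoc)
    next
      case False
      \<comment> \<open>Apart from \<open>X^k\<close> the term is a series in \<open>q^4\<close>, so
        it misses the class of \<open>n\<close>.\<close>
      have "dissected 0 4 (psi 8 ^ k * phi 4 ^ (114 * m + 1 - k + m) * G)"
        using assms(7) dissected_phi_4(1)
        by (intro dissected_mult dissected_power dissected_mono [OF dissected_psi]) simp_all
      hence "vanishes 0 4 (n - k) (psi 8 ^ k * phi 4 ^ (114 * m + 1 - k + m) * G)" if "k \<le> n"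
        using that False n4 by (intro dissected_imp_vanishes) (auto simp: mod_eq_dvd_iff_nat [symmetric])
      hence "fps_nth (fps_X ^ k * (psi 8 ^ k * phi 4 ^ (114 * m + 1 - k + m) * G)) n = 0"
        by (auto simp: vanishes_def fps_X_power_mult_nth)
      thus ?thesis
        by (simp add: theta_term_def mult.assoc)
    qed
  qed (use assms(8) n in \<open>simp add: vanishes_def\<close>)
  hence "M dvd (\<Sum>k\<le>N. fps_nth (theta_term e m k * G) n)"
    by (intro dvd_sum) simp
  also have "(\<Sum>k\<le>N. fps_nth (theta_term e m k * G) n) = fps_nth ((\<Sum>k\<le>N. theta_term e m k) * G) n"
    by (simp add: sum_distrib_right fps_sum_nth)
  finally have "M dvd fps_nth ((\<Sum>k\<le>N. theta_term e m k) * G) n" .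
  moreover obtain K where "D - (\<Sum>i\<le>N. theta_term e m i) = 128 * K"
    using assms(6) by (rule dvdE)
  hence "D * G = (\<Sum>i\<le>N. theta_term e m i) * G + fps_const 128 * (K * G)"
    by (simp add: numeral_fps_const [symmetric] algebra_simps)
  ultimately show "M dvd fps_nth (D * G) n"
    using assms(4) by simp
qed

lemma vanishes_theta_term_trivial:
  "M dvd 2 ^ i * e i \<Longrightarrow> vanishes M \<mu> r (theta_term e m i * G)"
  unfolding theta_term_def mult.assoc by (rule vanishes_const_mult_trivial)

text \<open>After removing \<open>X^i\<close> and the series \<open>psi 8 ^ i\<close> in
  \<open>q^8\<close>, the class \<open>4 + i\<close> becomes the class 4 of a power of
  \<open>phi 4\<close>, which contributes the divisor \<open>c\<close>.\<close>

lemma vanishes_theta_term: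
  assumes "vanishes c 8 4 (phi 4 ^ (114 * m + 1 - i + m))" "M dvd 2 ^ i * e i * c"
  shows "vanishes M 8 (4 + i) (theta_term e m i * 1)"
proof -
  have "vanishes c 8 (4 + i) (fps_X ^ i * (phi 4 ^ (114 * m + 1 - i + m) * psi 8 ^ i))"
    using assms(1) dissected_psi[of 8]
    by (intro vanishes_X_power_mult vanishes_mult dissected_weaken [OF dissected_power])
  hence "vanishes M 8 (4 + i) (fps_const (2 ^ i * e i) * (fps_X ^ i * (phi 4 ^ (114 * m + 1 - i + m) * psi 8 ^ i)))"
    using assms(2) by (rule vanishes_const_mult)
  thus ?thesis
    by (simp add: theta_term_def mult_ac)
qed

lemma vanishes_phi_4_power: "vanishes 2 8 4 (phi 4 ^ k)"
  by (intro dissected_imp_vanishes dissected_power dissected_mono [OF dissected_phi_4(2)]) simp_all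

lemma vanishes_phi_4_even_power:
  assumes "even k"
  shows "vanishes 4 8 4 (phi 4 ^ k)"
proof -
  from assms obtain l where "k = 2 * l" ..
  hence "dissected 4 8 (phi 4 ^ k)"
    using dissected_power[OF dissected_phi_4(3), of l] by (simp add: power_mult)
  thus ?thesis
    by (rule dissected_imp_vanishes) simp
qed

text \<open>Divisibility by 8 holds first on the class modulo 8; multiplying by
  \<open>euler_f 8 ^ i\<close> then gains a factor 2 on the class modulo 16, and
  \<open>vanishes_cancel_refined\<close> removes the multiplier.\<close>

lemma vanishes_diamond_gf_16:
  assumes "i \<in> {2, 3}" "even (Suc j + i)" "8 dvd 2 ^ i * e i"
    and dvd: "128 dvd diamond_gf (8 * j + 7) * cofactor (Suc j) - (\<Sum>i\<le>N. theta_term e (Suc j) i)"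
  shows "vanishes 16 16 (8 + i) (diamond_gf (8 * j + 7))"
proof -
  define D where "D = diamond_gf (8 * j + 7)"
  define W where "W = phi 4 ^ (114 * Suc j + 1 - i + Suc j)"
  define E where "E = cofactor (Suc j) * euler_f 8 ^ i"
  have i: "8 dvd (2 :: int) ^ (i + 4)" "16 dvd (2 :: int) ^ (i + 4)" "i < 4"
    using assms(1) by auto
  have mod: "(8 + i) mod 4 = i"
    using assms(1) by auto
  have euler: "dissected 0 8 (euler_f 8 ^ i)"
    by (intro dissected_power dissected_euler_f) simp
  have E8: "dissected 0 8 E"
    unfolding E_def by (intro dissected_mult dissected_cofactor euler)
  have E0: "fps_nth E 0 = 1"
    by (simp add: E_def cofactor_nth_0 fps_nth_power_0 euler_f_has_prod(2))
  have "vanishes 8 8 (8 + i) (D * cofactor (Suc j) * 1)"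
    unfolding D_def using assms(3) i mod
    by (intro vanishes_diamond_gf_mult [OF _ _ _ _ _ dvd, where i = i]
        vanishes_theta_term_trivial dissected_1) simp_all
  hence D8: "vanishes 8 8 (8 + i) D"
    using vanishes_cancel[OF dissected_weaken[OF dissected_cofactor] cofactor_nth_0] by simp
  have E16: "dissected 2 16 E"
  proof -
    \<comment> \<open>The parity condition makes all factors \<open>f_8\<close> pair up into
      \<open>f_8^2 = f_16 phi_minus 8\<close>, modulo 2 a series in \<open>q^16\<close>.\<close>
    obtain h where h: "Suc j + i = 2 * h"
      using assms(2) ..
    have "E = euler_f 8 ^ Suc j * euler_f 8 ^ i * (phi_minus 4 * phi 4) ^ Suc j"
      by (simp only: E_def cofactor_def mult_ac)
    also have "euler_f 8 ^ Suc j * euler_f 8 ^ i = (euler_f 8 ^ 2) ^ h"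
      by (simp only: power_add [symmetric] power_mult [symmetric] h)
    also have "euler_f 8 ^ 2 = euler_f 16 * phi_minus 8"
      using euler_f_square[of 8] by simp
    finally have "E = (euler_f 16 * phi_minus 8) ^ h * (phi_minus 4 * phi 4) ^ Suc j" .
    moreover have "dissected 2 16 (phi_minus 8)"
    proof -
      have "dissected 0 16 (phi 32)"
        by (rule dissected_mono [OF dissected_phi]) simp_all
      from dissected_add_multiple[OF this, of 2 "- (fps_X ^ 8 * psi 64)"] show ?thesis
        by (simp add: phi_minus_def numeral_fps_const mult.assoc)
    qed
    moreover have "dissected 2 16 (euler_f 16)"
      by (rule dissected_weaken [OF dissected_euler_f]) simp
    ultimately show ?thesis
      by (simp only: dissected_mult dissected_power dissected_phi_4_mult_minus)
  qed
  have "vanishes 16 16 (8 + i) (theta_term e (Suc j) i * euler_f 8 ^ i)"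
  proof -
    have "theta_term e (Suc j) i * euler_f 8 ^ i =
        fps_const (2 ^ i * e i) * (fps_X ^ i * ((psi 8 * euler_f 8) ^ i * W))"
      by (simp only: theta_term_def W_def power_mult_distrib mult_ac)
    \<comment> \<open>This replaces \<open>psi 8\<close>, a series in \<open>q^8\<close>, by a
      series in \<open>q^16\<close>.\<close>
    also have "psi 8 * euler_f 8 = euler_f 16 ^ 2"
      using psi_euler_f[of 8] by simp
    finally have eq: "theta_term e (Suc j) i * euler_f 8 ^ i =
        fps_const (2 ^ i * e i) * (fps_X ^ i * ((euler_f 16 ^ 2) ^ i * W))" .
    have "dissected 2 16 ((euler_f 16 ^ 2) ^ i * W)"
      unfolding W_def using dissected_phi_4(2)
      by (intro dissected_mult dissected_power dissected_weaken [OF dissected_euler_f]) simp_all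
    hence vanishes: "vanishes 2 16 (8 + i) (fps_X ^ i * ((euler_f 16 ^ 2) ^ i * W))"
      by (intro vanishes_X_power_mult dissected_imp_vanishes) simp_all
    have "8 * 2 dvd 2 ^ i * e i * 2"
      using assms(3) by (rule mult_dvd_mono) simp
    hence "16 dvd 2 ^ i * e i * 2"
      by simp
    with vanishes show ?thesis
      unfolding eq by (rule vanishes_const_mult)
  qed
  hence "vanishes 16 16 (8 + i) (D * cofactor (Suc j) * euler_f 8 ^ i)"
    unfolding D_def using i mod
    by (intro vanishes_diamond_gf_mult [OF _ _ _ _ _ dvd, where i = i] dissected_mono [OF euler]) simp_all
  hence "vanishes (8 * 2) 16 (8 + i) (D * E)"
    by (simp only: E_def mult.assoc) simp
  with D8 dissected_weaken[OF E8] E16 E0 _ refl have "vanishes (8 * 2) 16 (8 + i) D"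
    by (rule vanishes_cancel_refined) simp
  thus ?thesis by (simp add: D_def)
qed

text \<open>Only the \<open>x^3\<close> term matters: the next one in its class, \<open>x^7\<close>,
  is divisible by 128.\<close>

lemma vanishes_diamond_gf_4:
  assumes "M dvd 128" "M dvd 8 * ((int j + 1) * (12 * int j + 11) * (24 * int j - 37))"
  shows "vanishes M 4 3 (diamond_gf (8 * j + 7))"
proof -
  obtain e where e: "e 3 = (int j + 1) * (12 * int j + 11) * (24 * int j - 37)"
    and dvd: "128 dvd diamond_gf (8 * j + 7) * cofactor (Suc j) -
      (\<Sum>i\<le>114 * Suc j + 1. theta_term e (Suc j) i)"
    by (rule diamond_gf_expansion)
  have "vanishes M 4 3 (diamond_gf (8 * j + 7) * cofactor (Suc j) * 1)"
    using assms e
    by (intro vanishes_diamond_gf_mult [OF _ _ _ _ _ dvd, where i = 3]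
        vanishes_theta_term_trivial dissected_1) simp_all
  hence "vanishes M 4 3 (diamond_gf (8 * j + 7) * cofactor (Suc j))"
    by simp
  moreover have "dissected M 4 (cofactor (Suc j))"
    by (rule dissected_mono [OF dissected_cofactor]) simp_all
  ultimately show ?thesis
    using vanishes_cancel[OF _ cofactor_nth_0] by blast
qed

text \<open>Combines \<open>2 ^ i\<close>, the coefficient \<open>e i\<close> and the divisor
  \<open>c\<close> from the total power \<open>115 * Suc j + 1 - i\<close> of
  \<open>phi 4\<close>.\<close>

lemma vanishes_diamond_gf_8:
  assumes "i \<in> {2, 3}" "M dvd 128" "M dvd 2 ^ (i + 4)"
    and "vanishes c 8 4 (phi 4 ^ (115 * Suc j + 1 - i))"
    and "M dvd 2 ^ i * (if i = 2 then 3 * (int j + 1) * (24 * int j + 1)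
      else (int j + 1) * (12 * int j + 11) * (24 * int j - 37)) * c"
  shows "vanishes M 8 (4 + i) (diamond_gf (8 * j + 7))"
proof -
  obtain e where e: "e 2 = 3 * (int j + 1) * (24 * int j + 1)"
      "e 3 = (int j + 1) * (12 * int j + 11) * (24 * int j - 37)"
    and dvd: "128 dvd diamond_gf (8 * j + 7) * cofactor (Suc j) -
      (\<Sum>i\<le>114 * Suc j + 1. theta_term e (Suc j) i)"
    by (rule diamond_gf_expansion)
  have "114 * Suc j + 1 - i + Suc j = 115 * Suc j + 1 - i"
    using assms(1) by auto
  hence "vanishes c 8 4 (phi 4 ^ (114 * Suc j + 1 - i + Suc j))"
    using assms(4) by (simp only:)
  moreover have "M dvd 2 ^ i * e i * c"
    using assms(1,5) e by auto
  ultimately have "vanishes M 8 (4 + i) (theta_term e (Suc j) i * 1)"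
    by (rule vanishes_theta_term)
  hence "vanishes M 8 (4 + i) (diamond_gf (8 * j + 7) * cofactor (Suc j) * 1)"
    using assms(1-3) by (intro vanishes_diamond_gf_mult [OF _ _ _ _ _ dvd, where i = i] dissected_1) auto
  thus ?thesis
    using vanishes_cancel[OF dissected_weaken[OF dissected_cofactor] cofactor_nth_0] by simp
qed

section \<open>Congruences for the coefficients\<close>

lemma diamond_d_cong_0:
  assumes "vanishes M m r (diamond_gf k)" "n mod m = r mod m"
  shows "[diamond_d k n = 0] (mod M)"
  using assms by (simp add: vanishes_def diamond_d_def cong_0_iff)

lemma diamond_d_8n_6:
  "[diamond_d (8 * j + 7) (8 * n + 6) = 0] (mod 16)"
proof (rule diamond_d_cong_0)
  have "vanishes 16 8 (4 + 2) (diamond_gf (8 * j + 7))"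
  \<comment> \<open>For even \<open>j\<close> the power of \<open>phi 4\<close> is even and gives 4;
    for odd \<open>j\<close> it gives 2 and the factor \<open>j + 1\<close> another 2. Either way
    \<open>2 ^ 2\<close> is raised to 16.\<close>
  proof (cases "even j")
    case True
    hence "even (115 * Suc j + 1 - 2)"
      by simp
    moreover have "16 dvd 2 ^ 2 * (3 * (int j + 1) * (24 * int j + 1)) * 4"
      by (rule dvdI [where k = "3 * (int j + 1) * (24 * int j + 1)"]) simp
    ultimately show ?thesis
      by (intro vanishes_diamond_gf_8 [where c = 4] vanishes_phi_4_even_power) simp_all
  next
    case False
    then obtain l where "j = 2 * l + 1"
      by (rule oddE)
    hence "16 dvd 2 ^ 2 * (3 * (int j + 1) * (24 * int j + 1)) * 2"
      by (intro dvdI [where k = "3 * (int l + 1) * (24 * int j + 1)"]) simp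
    thus ?thesis
      by (intro vanishes_diamond_gf_8 [where c = 2] vanishes_phi_4_power) simp_all
  qed
  thus "vanishes 16 8 6 (diamond_gf (8 * j + 7))"
    by simp
qed (simp add: mod_simps)

lemma diamond_d_8n_7:
  "[diamond_d (8 * j + 7) (8 * n + 7) = 0] (mod 16)"
proof (rule diamond_d_cong_0)
  have "vanishes 16 8 (4 + 3) (diamond_gf (8 * j + 7))"
    by (intro vanishes_diamond_gf_8 [where c = 2] vanishes_phi_4_power) simp_all
  thus "vanishes 16 8 7 (diamond_gf (8 * j + 7))"
    by simp
qed (simp add: mod_simps)

text \<open>Here \<open>j\<close> is odd, so the power of \<open>phi 4\<close> is even:
  \<open>2 ^ 3\<close> from \<open>x^3\<close>, 4 from \<open>phi 4\<close> and \<open>2 ^ k\<close>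
  from \<open>j + 1\<close>.\<close>

lemma diamond_d_8n_7_dvd:
  assumes "2 ^ k dvd j + 1" "k \<in> {1, 2}"
  shows "[diamond_d (8 * j + 7) (8 * n + 7) = 0] (mod 2 ^ (k + 5))"
proof (rule diamond_d_cong_0)
  have "2 dvd (2 :: nat) ^ k"
    using assms(2) by auto
  hence "odd j"
    using dvd_trans[OF _ assms(1), of 2] by simp
  have "int (2 ^ k) dvd int (j + 1)"
    using assms(1) by (simp only: of_nat_dvd_iff)
  hence "2 ^ k dvd int j + 1"
    by (simp add: add.commute)
  hence "2 ^ k * 32 dvd (int j + 1) * (32 * ((12 * int j + 11) * (24 * int j - 37)))"
    by (rule mult_dvd_mono) simp
  hence "2 ^ (k + 5) dvd 2 ^ 3 * ((int j + 1) * (12 * int j + 11) * (24 * int j - 37)) * 4"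
    by (simp add: power_add mult_ac)
  hence "vanishes (2 ^ (k + 5)) 8 (4 + 3) (diamond_gf (8 * j + 7))"
    using \<open>odd j\<close> assms(2)
    by (intro vanishes_diamond_gf_8 [where c = 4] vanishes_phi_4_even_power) auto
  thus "vanishes (2 ^ (k + 5)) 8 7 (diamond_gf (8 * j + 7))"
    by simp
qed (simp add: mod_simps)

lemma diamond_d_4n_3_dvd:
  assumes "2 ^ k dvd j + 1" "k \<in> {1, 2}"
  shows "[diamond_d (8 * j + 7) (4 * n + 3) = 0] (mod 2 ^ (k + 3))"
proof (rule diamond_d_cong_0)
  have "int (2 ^ k) dvd int (j + 1)"
    using assms(1) by (simp only: of_nat_dvd_iff)
  hence "2 ^ k dvd int j + 1"
    by (simp add: add.commute)
  hence "2 ^ k * 8 dvd (int j + 1) * (8 * ((12 * int j + 11) * (24 * int j - 37)))"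
    by (rule mult_dvd_mono) simp
  hence "2 ^ (k + 3) dvd 8 * ((int j + 1) * (12 * int j + 11) * (24 * int j - 37))"
    by (simp add: power_add mult_ac)
  thus "vanishes (2 ^ (k + 3)) 4 3 (diamond_gf (8 * j + 7))"
    using assms(2) by (intro vanishes_diamond_gf_4) auto
qed (simp add: mod_simps)

text \<open>The case \<open>i = 2\<close>: for odd \<open>j\<close>, \<open>e 2\<close> is even and
  \<open>Suc j + 2\<close> has the required parity.\<close>

lemma diamond_d_16n_10:
  assumes "odd j"
  shows "[diamond_d (8 * j + 7) (16 * n + 10) = 0] (mod 16)"
proof (rule diamond_d_cong_0)
  obtain e where e: "e 2 = 3 * (int j + 1) * (24 * int j + 1)"
    and dvd: "128 dvd diamond_gf (8 * j + 7) * cofactor (Suc j) -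
      (\<Sum>i\<le>114 * Suc j + 1. theta_term e (Suc j) i)"
    by (rule diamond_gf_expansion)
  obtain l where "j = 2 * l + 1"
    using assms by (rule oddE)
  hence "8 dvd 2 ^ 2 * e 2"
    unfolding e by (intro dvdI [where k = "3 * (int l + 1) * (24 * int j + 1)"]) simp
  hence "vanishes 16 16 (8 + 2) (diamond_gf (8 * j + 7))"
    using assms by (intro vanishes_diamond_gf_16 [OF _ _ _ dvd]) simp_all
  thus "vanishes 16 16 10 (diamond_gf (8 * j + 7))"
    by simp
qed (simp add: mod_simps)

text \<open>The case \<open>i = 3\<close>: the 8 is \<open>2 ^ 3\<close> itself, and the parity
  condition selects even \<open>j\<close>.\<close>

lemma diamond_d_16n_11:
  assumes "even j"
  shows "[diamond_d (8 * j + 7) (16 * n + 11) = 0] (mod 16)"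
proof (rule diamond_d_cong_0)
  obtain e where dvd: "128 dvd diamond_gf (8 * j + 7) * cofactor (Suc j) -
      (\<Sum>i\<le>114 * Suc j + 1. theta_term e (Suc j) i)"
    by (rule diamond_gf_expansion)
  have "vanishes 16 16 (8 + 3) (diamond_gf (8 * j + 7))"
    using assms by (intro vanishes_diamond_gf_16 [OF _ _ _ dvd]) simp_all
  thus "vanishes 16 16 11 (diamond_gf (8 * j + 7))"
    by simp
qed (simp add: mod_simps)

theorem theorem4p1:
  fixes n j :: nat
  shows "[diamond_d (8 * j + 7) (8 * n + 6) = 0] (mod 8) \<and>
         [diamond_d (8 * j + 7) (8 * n + 7) = 0] (mod 16) \<and>
         [diamond_d (16 * j + 7) (8 * n + 6) = 0] (mod 16) \<and>
         [diamond_d (16 * j + 7) (16 * n + 11) = 0] (mod 16) \<and>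
         [diamond_d (16 * j + 15) (4 * n + 3) = 0] (mod 16) \<and>
         [diamond_d (16 * j + 15) (8 * n + 6) = 0] (mod 16) \<and>
         [diamond_d (16 * j + 15) (16 * n + 10) = 0] (mod 16) \<and>
         [diamond_d (32 * j + 31) (4 * n + 3) = 0] (mod 32) \<and>
         [diamond_d (16 * j + 15) (8 * n + 7) = 0] (mod 64) \<and>
         [diamond_d (32 * j + 31) (8 * n + 7) = 0] (mod 128)"
proof (intro conjI)
  \<comment> \<open>The index is specialised to \<open>2j\<close>, \<open>2j+1\<close> and
    \<open>4j+3\<close>; its successor is divisible by 2 in the second case and by 4 in the
    third.\<close>
  have k: "8 * (2 * j) + 7 = 16 * j + 7" "8 * (2 * j + 1) + 7 = 16 * j + 15"
    "8 * (4 * j + 3) + 7 = 32 * j + 31"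
    by simp_all
  have "2 * j + 1 + 1 = 2 ^ 1 * (j + 1)" "4 * j + 3 + 1 = 2 ^ 2 * (j + 1)"
    by simp_all
  hence dvd: "2 ^ 1 dvd 2 * j + 1 + 1" "2 ^ 2 dvd 4 * j + 3 + 1"
    by (metis dvd_triv_left)+
  show "[diamond_d (8 * j + 7) (8 * n + 6) = 0] (mod 8)"
    using diamond_d_8n_6 by (rule cong_dvd_modulus) simp
  show "[diamond_d (8 * j + 7) (8 * n + 7) = 0] (mod 16)"
    by (rule diamond_d_8n_7)
  show "[diamond_d (16 * j + 7) (8 * n + 6) = 0] (mod 16)"
    using diamond_d_8n_6[of "2 * j" n] unfolding k .
  show "[diamond_d (16 * j + 7) (16 * n + 11) = 0] (mod 16)"
    using diamond_d_16n_11[of "2 * j" n] unfolding k by simp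
  show "[diamond_d (16 * j + 15) (4 * n + 3) = 0] (mod 16)"
    using diamond_d_4n_3_dvd[OF dvd(1), of n] unfolding k by simp
  show "[diamond_d (16 * j + 15) (8 * n + 6) = 0] (mod 16)"
    using diamond_d_8n_6[of "2 * j + 1" n] unfolding k .
  show "[diamond_d (16 * j + 15) (16 * n + 10) = 0] (mod 16)"
    using diamond_d_16n_10[of "2 * j + 1" n] unfolding k by simp
  show "[diamond_d (32 * j + 31) (4 * n + 3) = 0] (mod 32)"
    using diamond_d_4n_3_dvd[OF dvd(2), of n] unfolding k by simp
  show "[diamond_d (16 * j + 15) (8 * n + 7) = 0] (mod 64)"
    using diamond_d_8n_7_dvd[OF dvd(1), of n] unfolding k by simp
  show "[diamond_d (32 * j + 31) (8 * n + 7) = 0] (mod 128)"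
    using diamond_d_8n_7_dvd[OF dvd(2), of n] unfolding k by simp
qed

end
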